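(* Let $p>2$ be a prime, $\mathbf{F}$ a field of characteristic $p$, and $M\in\mathbf{F}^{2\times4}$. If $\gamma_{1234}(M)\neq0$, $\gamma_{1235}(M)=0$, $\gamma_{1357}(M)\neq0$ and $\gamma_{1245}(M)=0$, then, with $\widehat{f_1},\widehat{h_2}$ and $N_M(z)$ as defined in the context, the set $\mathcal B:=\{x,\widehat{f_1},\widehat{h_2},N_M(z)\}$ is a SAGBI basis for $\mathbf{F}[V_M]^E$. Furthermore, $\mathbf{F}[V_M]^E$ is a hypersurface with the relation coming from the subduction of the tête-à-tête $(\widehat{h_2}^{p^2},\widehat{f_1}^{p^2+2})$.
   Context: For $M=(c_{ij})\in\mathbf{F}^{2\times4}$, $E=\langle e_1,e_2,e_3,e_4\rangle\cong(\mathbf{Z}/p)^4$ acts on $\mathbf{F}[V_M]=\mathbf{F}[x,y,z]$ (on the right, by algebra automorphisms) by $x\cdot e_j=x$, $y\cdot e_j=y+c_{1j}x$, $z\cdot e_j=z+2c_{1j}y+(c_{1j}^2+c_{2j})x$; $\mathbf{F}[V_M]^E$ is the ring of invariants. For $f\in\mathbf{F}[V_M]$, $N_M(f)$ is the product of the distinct elements of the $E$-orbit of $f$. Minors: $\Gamma(M)$ is the $10\times4$ matrix whose row $2k+1$ is $(c_{11}^{p^k},\dots,c_{14}^{p^k})$ and whose row $2k+2$ is $(c_{21}^{p^k},\dots,c_{24}^{p^k})$, $k=0,\dots,4$; $\gamma_{ijk\ell}(M)$ is its $4\times4$ minor with rows $i,j,k,\ell$, written $\bar\gamma_{ijk\ell}$.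 Put $\delta:=y^2-xz$. Under the hypotheses of the claim one has $\bar\gamma_{1345}\neq0$, and one defines $$\widehat{f_1}:=y^{p^2}+\frac{\bar\gamma_{1245}}{\bar\gamma_{1234}}y^px^{p^2-p}+\frac{\bar\gamma_{1345}}{\bar\gamma_{1234}}\delta x^{p^2-2}+\frac{\bar\gamma_{2345}}{\bar\gamma_{1234}}yx^{p^2-1}$$ (the second term vanishes when $\bar\gamma_{1245}=0$), $$\widetilde{h_2}:=N_M(y)-\widehat{f_1}^{p^2}+\alpha_1\widehat{f_1}^px^{p^4-p^3}+\alpha_2\widehat{f_1}^2x^{p^4-2p^2},\quad \alpha_1:=\frac{\bar\gamma_{1359}}{\bar\gamma_{1357}}+\frac{\bar\gamma_{1245}^{p^2}}{\bar\gamma_{1234}^{p^2}},\quad \alpha_2:=\frac{\bar\gamma_{1345}^{p^2}}{\bar\gamma_{1234}^{p^2}},$$ $$\widehat{h_2}:=\frac{\bar\gamma_{1234}^{p^2+1}\,\widetilde{h_2}}{2x^{p^4-p^2-2}\,\bar\gamma_{1345}^{p^2+1}}.$$ These are elements of $\mathbf{F}[V_M]^E$ with lead terms $y^{p^2}$ and $y^{p^2+2}$ for $\widehat{f_1}$ and $\widehat{h_2}$ respectively. Conventions: graded reverse lexicographic order with $x<y<z$; $\mathrm{LM}$, $\mathrm{LT}$ denote lead monomial and lead term (with coefficient). A finite subset $\mathcal B=\{b_1,\dots,b_m\}$ of a subalgebra $A$ of a polynomial ring is a SAGBI basis for $A$ if the monomials $\mathrm{LM}(b_i)$ generate the algebra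 spanned by the lead monomials of the elements of $A$. A tête-à-tête is a pair $(b^I,b^J)$ of products of elements of $\mathcal B$ with $\mathrm{LM}(b^I)=\mathrm{LM}(b^J)$. Its subduction: choose a scalar $c$ with $\mathrm{LT}(b^I)=\mathrm{LT}(cb^J)$ and repeatedly cancel the lead term of $b^I-cb^J$ by scalar multiples of products of elements of $\mathcal B$; if this ends at zero, it expresses $b^I-cb^J$ as a polynomial in $\mathcal B$, giving a relation. "Hypersurface with the relation coming from the subduction of" a tête-à-tête means that the kernel of the surjection from the polynomial ring on $m$ variables sending the variables to $b_1,\dots,b_m$ is the principal ideal generated by the relation so obtained. *)

theory Defs
  imports
    "HOL-Analysis.Analysis"
    "HOL-Library.Poly_Mapping"
    "HOL-Computational_Algebra.Primes"
    "HOL-Algebra.Product_Groups"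
    "HOL-Algebra.Group_Action"
begin

section \<open>Polynomial rings\<close>

text \<open>The polynomial ring over \<open>'a\<close> whose variables are indexed by the type \<open>'v\<close>:
  finitely supported functions from exponent vectors to coefficients, with the ring structure
  (convolution product) of \<^theory>\<open>HOL-Library.Poly_Mapping\<close>.\<close>

type_synonym ('v, 'a) mpoly = "('v \<Rightarrow>\<^sub>0 nat) \<Rightarrow>\<^sub>0 'a"

definition Const :: "'a::zero \<Rightarrow> ('v, 'a) mpoly" where
  "Const c = Poly_Mapping.single 0 c"

definition Var :: "'v \<Rightarrow> ('v, 'a::zero_neq_one) mpoly" where
  "Var v = Poly_Mapping.single (Poly_Mapping.single v 1) 1"

definition power_product :: "('i \<Rightarrow> 'b::comm_monoid_mult) \<Rightarrow> ('i \<Rightarrow>\<^sub>0 nat) \<Rightarrow> 'b" where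
  "power_product b I = (\<Prod>i\<in>Poly_Mapping.keys I. b i ^ Poly_Mapping.lookup I i)"

text \<open>The algebra homomorphism sending the variable \<open>i\<close> to \<open>b i\<close>.\<close>

definition subst :: "('i \<Rightarrow> ('v, 'a) mpoly) \<Rightarrow> ('i, 'a::comm_ring_1) mpoly \<Rightarrow> ('v, 'a) mpoly" where
  "subst b q = (\<Sum>I\<in>Poly_Mapping.keys q. Const (Poly_Mapping.lookup q I) * power_product b I)"

definition subalgebra :: "('v, 'a::comm_ring_1) mpoly set \<Rightarrow> bool" where
  "subalgebra A \<longleftrightarrow>
     range Const \<subseteq> A \<and> (\<forall>f\<in>A. \<forall>g\<in>A. f + g \<in> A) \<and> (\<forall>f\<in>A. \<forall>g\<in>A. f * g \<in> A)"

section \<open>Lead terms, SAGBI bases and subduction\<close>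

definition total_degree :: "('v \<Rightarrow>\<^sub>0 nat) \<Rightarrow> nat" where
  "total_degree m = (\<Sum>v\<in>Poly_Mapping.keys m. Poly_Mapping.lookup m v)"

text \<open>Graded reverse lexicographic order, the variables being ordered as in the type \<open>'v\<close>:
  among monomials of equal degree, the one with the larger exponent at the smallest variable
  where the two differ is the smaller monomial.\<close>

definition grevlex_less :: "('v::linorder \<Rightarrow>\<^sub>0 nat) \<Rightarrow> ('v \<Rightarrow>\<^sub>0 nat) \<Rightarrow> bool" where
  "grevlex_less m n \<longleftrightarrow> total_degree m < total_degree n \<or>
     total_degree m = total_degree n \<and>
     (\<exists>v. Poly_Mapping.lookup n v < Poly_Mapping.lookup m v \<and>
          (\<forall>w<v. Poly_Mapping.lookup m w = Poly_Mapping.lookup n w))"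

text \<open>Unspecified for the zero polynomial.\<close>

definition lead_exp :: "('v::linorder, 'a::zero) mpoly \<Rightarrow> 'v \<Rightarrow>\<^sub>0 nat" where
  "lead_exp f = (THE m. m \<in> Poly_Mapping.keys f \<and>
     (\<forall>n\<in>Poly_Mapping.keys f. n \<noteq> m \<longrightarrow> grevlex_less n m))"

definition LM :: "('v::linorder, 'a::zero_neq_one) mpoly \<Rightarrow> ('v, 'a) mpoly" where
  "LM f = Poly_Mapping.single (lead_exp f) 1"

text \<open>Since \<open>single m 0 = 0\<close>, the lead term of the zero polynomial is \<open>0\<close>.\<close>

definition LT :: "('v::linorder, 'a::zero) mpoly \<Rightarrow> ('v, 'a) mpoly" where
  "LT f = Poly_Mapping.single (lead_exp f) (Poly_Mapping.lookup f (lead_exp f))"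

text \<open>The algebra spanned by the lead monomials of \<open>A\<close> is their linear span.\<close>

definition sagbi_basis :: "('v::linorder, 'a::field) mpoly set \<Rightarrow> ('v, 'a) mpoly set \<Rightarrow> bool" where
  "sagbi_basis B A \<longleftrightarrow> subalgebra A \<and> finite B \<and> B \<subseteq> A \<and>
     subalgebra hull (LM ` (B - {0})) = module.span (\<lambda>c f. Const c * f) (LM ` (A - {0}))"

text \<open>\<open>subducts_to_zero b f Q\<close>: repeatedly cancelling the lead term of \<open>f\<close> by scalar multiples
  of products of the \<open>b i\<close> ends at zero, and \<open>Q\<close> records the multiples used, so that
  \<open>f = subst b Q\<close>.\<close>

inductive subducts_to_zero ::
  "('i \<Rightarrow> ('v::linorder, 'a::field) mpoly) \<Rightarrow> ('v, 'a) mpoly \<Rightarrow> ('i, 'a) mpoly \<Rightarrow> bool"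
  for b where
  zero: "subducts_to_zero b 0 0"
| cancel: "f \<noteq> 0 \<Longrightarrow> LT f = LT (Const c * power_product b I) \<Longrightarrow>
     subducts_to_zero b (f - Const c * power_product b I) Q \<Longrightarrow>
     subducts_to_zero b f (Poly_Mapping.single I c + Q)"

text \<open>\<open>R\<close> is a relation obtained from a subduction (to zero) of the tete-a-tete \<open>(b\<^sup>I, b\<^sup>J)\<close>.\<close>

definition tete_a_tete_relation ::
  "('i \<Rightarrow> ('v::linorder, 'a::field) mpoly) \<Rightarrow> ('i \<Rightarrow>\<^sub>0 nat) \<Rightarrow> ('i \<Rightarrow>\<^sub>0 nat) \<Rightarrow> ('i, 'a) mpoly \<Rightarrow> bool"
  where
  "tete_a_tete_relation b I J R \<longleftrightarrow>
     LM (power_product b I) = LM (power_product b J) \<and>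
     (\<exists>c Q. LT (power_product b I) = LT (Const c * power_product b J) \<and>
        subducts_to_zero b (power_product b I - Const c * power_product b J) Q \<and>
        R = Poly_Mapping.single I 1 - Poly_Mapping.single J c - Q)"

text \<open>The multiples of \<open>R\<close> form the principal ideal generated by \<open>R\<close>.\<close>

definition hypersurface_with_relation ::
  "('i \<Rightarrow> ('v, 'a::field) mpoly) \<Rightarrow> ('v, 'a) mpoly set \<Rightarrow> ('i, 'a) mpoly \<Rightarrow> bool" where
  "hypersurface_with_relation b A R \<longleftrightarrow>
     range (subst b) = A \<and> {q. subst b q = 0} = {q. R dvd q}"

section \<open>The representation\<close>

datatype xyz = X | Y | Z

instantiation xyz :: linorder
begin

definition less_eq_xyz :: "xyz \<Rightarrow> xyz \<Rightarrow> bool" where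
  "less_eq_xyz v w \<longleftrightarrow> v = X \<or> w = Z \<or> v = w"

definition less_xyz :: "xyz \<Rightarrow> xyz \<Rightarrow> bool" where
  "less_xyz v w \<longleftrightarrow> v \<le> w \<and> v \<noteq> w"

instance
proof
  fix u v w :: xyz
  show "(u < v) = (u \<le> v \<and> \<not> v \<le> u)"
    by (cases u; cases v; simp add: less_eq_xyz_def less_xyz_def)
  show "u \<le> u" by (simp add: less_eq_xyz_def)
  show "u \<le> v \<Longrightarrow> v \<le> w \<Longrightarrow> u \<le> w"
    by (cases u; cases v; cases w; simp add: less_eq_xyz_def)
  show "u \<le> v \<Longrightarrow> v \<le> u \<Longrightarrow> u = v"
    by (cases u; cases v; simp add: less_eq_xyz_def)
  show "u \<le> v \<or> v \<le> u"
    by (cases u; cases v; simp add: less_eq_xyz_def)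
qed

end

text \<open>In the index type \<open>4\<close> the numerals \<open>1, 2, 3, 4\<close> are the four elements (and \<open>4 = 0\<close>).\<close>

definition gen_act :: "'a::field^4^2 \<Rightarrow> 4 \<Rightarrow> (xyz, 'a) mpoly \<Rightarrow> (xyz, 'a) mpoly" where
  "gen_act M j = subst (\<lambda>v. case v of
       X \<Rightarrow> Var X
     | Y \<Rightarrow> Var Y + Const (M$1$j) * Var X
     | Z \<Rightarrow> Var Z + Const (2 * M$1$j) * Var Y + Const ((M$1$j)\<^sup>2 + M$2$j) * Var X)"

definition elem_abelian4 :: "nat \<Rightarrow> (4 \<Rightarrow> int) monoid" where
  "elem_abelian4 p = product_group UNIV (\<lambda>_. integer_mod_group p)"

text \<open>The action of \<open>e\<^sub>1\<^bsup>g 1\<^esup> e\<^sub>2\<^bsup>g 2\<^esup> e\<^sub>3\<^bsup>g 3\<^esup> e\<^sub>4\<^bsup>g 4\<^esup>\<close>, with representatives \<open>0 \<le> g j < p\<close>.\<close>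

definition E_act :: "'a::field^4^2 \<Rightarrow> (4 \<Rightarrow> int) \<Rightarrow> (xyz, 'a) mpoly \<Rightarrow> (xyz, 'a) mpoly" where
  "E_act M g = (gen_act M 4 ^^ nat (g 4)) \<circ> (gen_act M 3 ^^ nat (g 3)) \<circ>
               (gen_act M 2 ^^ nat (g 2)) \<circ> (gen_act M 1 ^^ nat (g 1))"

definition E_invariants :: "nat \<Rightarrow> 'a::field^4^2 \<Rightarrow> (xyz, 'a) mpoly set" where
  "E_invariants p M = {f. \<forall>g\<in>carrier (elem_abelian4 p). E_act M g f = f}"

text \<open>The product over the orbit as a set, so each distinct element occurs once.\<close>

definition orbit_product :: "nat \<Rightarrow> 'a::field^4^2 \<Rightarrow> (xyz, 'a) mpoly \<Rightarrow> (xyz, 'a) mpoly" where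
  "orbit_product p M f = \<Prod>(orbit (elem_abelian4 p) (E_act M) f)"

section \<open>Minors and the generators\<close>

text \<open>The rows \<open>r = 1, \<dots>, 10\<close> of \<open>\<Gamma>(M)\<close>.\<close>

definition Gamma_row :: "nat \<Rightarrow> 'a::field^4^2 \<Rightarrow> nat \<Rightarrow> 'a^4" where
  "Gamma_row p M r =
     (\<chi> j. (if odd r then M$1$j else M$2$j) ^ (p ^ ((r - 1) div 2)))"

definition minor :: "nat \<Rightarrow> 'a::field^4^2 \<Rightarrow> nat \<Rightarrow> nat \<Rightarrow> nat \<Rightarrow> nat \<Rightarrow> 'a" where
  "minor p M i j k l =
     det (vector [Gamma_row p M i, Gamma_row p M j, Gamma_row p M k, Gamma_row p M l] :: 'a^4^4)"

definition delta :: "(xyz, 'a::field) mpoly" where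
  "delta = (Var Y)\<^sup>2 - Var X * Var Z"

definition f1_hat :: "nat \<Rightarrow> 'a::field^4^2 \<Rightarrow> (xyz, 'a) mpoly" where
  "f1_hat p M = Var Y ^ (p^2)
     + Const (minor p M 1 2 4 5 / minor p M 1 2 3 4) * Var Y ^ p * Var X ^ (p^2 - p)
     + Const (minor p M 1 3 4 5 / minor p M 1 2 3 4) * delta * Var X ^ (p^2 - 2)
     + Const (minor p M 2 3 4 5 / minor p M 1 2 3 4) * Var Y * Var X ^ (p^2 - 1)"

definition alpha1 :: "nat \<Rightarrow> 'a::field^4^2 \<Rightarrow> 'a" where
  "alpha1 p M = minor p M 1 3 5 9 / minor p M 1 3 5 7
     + minor p M 1 2 4 5 ^ (p^2) / minor p M 1 2 3 4 ^ (p^2)"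

definition alpha2 :: "nat \<Rightarrow> 'a::field^4^2 \<Rightarrow> 'a" where
  "alpha2 p M = minor p M 1 3 4 5 ^ (p^2) / minor p M 1 2 3 4 ^ (p^2)"

definition h2_tilde :: "nat \<Rightarrow> 'a::field^4^2 \<Rightarrow> (xyz, 'a) mpoly" where
  "h2_tilde p M = orbit_product p M (Var Y) - f1_hat p M ^ (p^2)
     + Const (alpha1 p M) * f1_hat p M ^ p * Var X ^ (p^4 - p^3)
     + Const (alpha2 p M) * (f1_hat p M)\<^sup>2 * Var X ^ (p^4 - 2 * p^2)"

text \<open>The quotient of \<open>\<gamma>\<^sub>1\<^sub>2\<^sub>3\<^sub>4\<^bsup>p\<^sup>2+1\<^esup> h2_tilde\<close> by \<open>2 x\<^bsup>p\<^sup>4-p\<^sup>2-2\<^esup> \<gamma>\<^sub>1\<^sub>3\<^sub>4\<^sub>5\<^bsup>p\<^sup>2+1\<^esup>\<close>; in the intended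
  situation the division is exact, and the quotient is unique as the ring is a domain.\<close>

definition h2_hat :: "nat \<Rightarrow> 'a::field^4^2 \<Rightarrow> (xyz, 'a) mpoly" where
  "h2_hat p M = (THE h.
     2 * Var X ^ (p^4 - p^2 - 2) * Const (minor p M 1 3 4 5 ^ (p^2 + 1)) * h =
     Const (minor p M 1 2 3 4 ^ (p^2 + 1)) * h2_tilde p M)"

definition generators :: "nat \<Rightarrow> 'a::field^4^2 \<Rightarrow> (xyz, 'a) mpoly ^ 4" where
  "generators p M = vector [Var X, f1_hat p M, h2_hat p M, orbit_product p M (Var Z)]"

end

theory Submission
  imports Defs "HOL-Computational_Algebra.Fraction_Field" "HOL-Computational_Algebra.Polynomial"
begin

text \<open>
  Write \<open>q\<close> for \<open>p\<^sup>2\<close>. An element of the group acts by \<open>y \<mapsto> y + a x\<close> and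
  \<open>\<delta> \<mapsto> \<delta> - b x\<^sup>2\<close>, where \<open>a\<close> and \<open>b\<close> are the combinations of the two rows of the matrix
  with coefficients in the prime field. The conditions on the minors imply that the entries of the
  first row are linearly independent over the prime field and that \<open>a\<^sup>q = c1 a + c2 b\<close> with
  \<open>c2 \<noteq> 0\<close>. So the group is an additive group \<open>A\<close> of \<open>p\<^sup>4\<close> scalars \<open>a\<close>, each of which determines its
  \<open>b\<close>, and \<open>f1 = y\<^sup>q + (c2 \<delta> - c1 y x) x\<^sup>q\<^sup>-\<^sup>2\<close> is invariant. Everything after this point uses
  \<open>A\<close>, \<open>c1\<close>, \<open>c2\<close> and the equation of degree \<open>p\<^sup>4\<close> satisfied on \<open>A\<close>; it is carried out in the
  locale \<open>translation_group\<close>.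

  Since \<open>f1\<close> is linear in \<open>z\<close> with coefficient \<open>- c2 x\<^sup>q\<^sup>-\<^sup>1\<close>, a power of \<open>x\<close> times any polynomial is a
  polynomial in \<open>y\<close> over \<open>R = F[x, f1]\<close>, on which the group acts by translating \<open>y\<close>. The invariants
  of translations of a variable over a domain are the polynomials in the norm of that variable
  (\<open>translation_invariant_poly\<close>). Therefore a power of \<open>x\<close> times any invariant lies in
  \<open>R[N(y)]\<close>, and so in \<open>R[h2]\<close>, because \<open>N(y)\<close> is linear in \<open>h2\<close> (\<open>Inv_in_h2\<close>). For \<open>N(z)\<close>
  degrees can be counted: each of its \<open>p\<^sup>4\<close> factors has degree \<open>q\<close> in \<open>y\<close>, whereas \<open>N(y)\<close> has degree
  \<open>p\<^sup>4\<close>; hence \<open>N(z)\<close> has degree exactly \<open>q\<close> in \<open>h2\<close>, with leading coefficient a scalar times a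
  power of \<open>x\<close> (\<open>Nz_in_h2\<close>). This replaces the explicit subduction of the tete-a-tete: it shows
  that a power of \<open>x\<close> times \<open>h2\<^sup>q\<close> lies in the span of the standard products
  \<open>x\<^sup>i f1\<^sup>j h2\<^sup>k N(z)\<^sup>l\<close> with \<open>k < q\<close>.

  The lead monomial of a standard product is \<open>x\<^sup>i y\<^sup>n z\<^sup>m\<close> with \<open>n = q j + (q + 2) k\<close> and
  \<open>m = p\<^sup>4 l\<close>. As \<open>q\<close> is odd, \<open>n\<close> modulo \<open>q\<close> determines \<open>k\<close>, so distinct standard
  products have distinct lead monomials and no lead terms cancel in a combination of them. As \<open>x\<close>
  is the smallest variable, it follows that a multiple of \<open>x\<close> in the span is \<open>x\<close> times an element
  of the span (\<open>standard_span_cancel_X\<close>). Powers of \<open>x\<close> can therefore be cancelled above: the span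
  contains \<open>h2\<^sup>q\<close>, is closed under multiplication by \<open>h2\<close>, and is the whole ring of invariants
  (\<open>Inv_eq_standard_span\<close>). In particular every lead monomial of an invariant is a product of lead
  monomials of the generators, which is the SAGBI property.

  Consequently every subduction of an invariant can be continued until it reaches zero. The
  products used in the subduction of the tete-a-tete have smaller lead monomials than \<open>h2\<^sup>q\<close>, so
  the relation obtained is monic of degree \<open>q\<close> in the variable of \<open>h2\<close>. Division by it leaves a
  combination of standard monomials, whose values are linearly independent; so the relation generates
  the kernel.
\<close>

section \<open>Ring morphisms and evaluation of polynomials\<close>

locale ring_morphism =
  fixes h :: "'r::comm_ring_1 \<Rightarrow> 's::comm_ring_1"
  assumes add: "h (a + b) = h a + h b"
    and mult: "h (a * b) = h a * h b"
    and one: "h 1 = 1"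
begin

lemma zero: "h 0 = 0"
  using add[of 0 0] by simp

lemma uminus: "h (- a) = - h a"
  using add[of a "- a"] zero by (simp add: eq_neg_iff_add_eq_0 add.commute)

lemma diff: "h (a - b) = h a - h b"
  using add[of a "- b"] uminus[of b] by simp

lemma power: "h (a ^ n) = h a ^ n"
  by (induction n) (simp_all add: one mult)

lemma sum: "h (sum f A) = (\<Sum>i\<in>A. h (f i))"
  by (induction A rule: infinite_finite_induct) (simp_all add: zero add)

lemma prod: "h (prod f A) = (\<Prod>i\<in>A. h (f i))"
  by (induction A rule: infinite_finite_induct) (simp_all add: one mult)

end

lemma power_product_superset:
  assumes "finite S" "Poly_Mapping.keys m \<subseteq> S"
  shows "power_product b m = (\<Prod>i\<in>S. b i ^ Poly_Mapping.lookup m i)"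
  unfolding power_product_def
  by (rule prod.mono_neutral_left) (use assms in \<open>auto simp: in_keys_iff\<close>)

lemma power_product_0 [simp]: "power_product b 0 = 1"
  by (simp add: power_product_def)

lemma power_product_single [simp]: "power_product b (Poly_Mapping.single i k) = b i ^ k"
  by (simp add: power_product_def)

lemma power_product_add: "power_product b (m + n) = power_product b m * power_product b n"
proof -
  let ?S = "Poly_Mapping.keys m \<union> Poly_Mapping.keys n"
  have "Poly_Mapping.keys (m + n) \<subseteq> ?S" by (rule Poly_Mapping.keys_add)
  then have "power_product b (m + n) = (\<Prod>i\<in>?S. b i ^ Poly_Mapping.lookup (m + n) i)"
    by (intro power_product_superset) auto
  also have "\<dots> = (\<Prod>i\<in>?S. b i ^ Poly_Mapping.lookup m i) * (\<Prod>i\<in>?S. b i ^ Poly_Mapping.lookup n i)"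
    by (simp add: lookup_add power_add prod.distrib)
  also have "\<dots> = power_product b m * power_product b n"
    by (subst (1 2) power_product_superset[where S = ?S]) auto
  finally show ?thesis .
qed

lemma sum_single_lookup:
  "(f :: 'k \<Rightarrow>\<^sub>0 'a::comm_monoid_add) = (\<Sum>m\<in>Poly_Mapping.keys f. Poly_Mapping.single m (Poly_Mapping.lookup f m))"
proof (rule poly_mapping_eqI)
  fix k
  have "Poly_Mapping.lookup (\<Sum>m\<in>Poly_Mapping.keys f. Poly_Mapping.single m (Poly_Mapping.lookup f m)) k
     = (\<Sum>m\<in>Poly_Mapping.keys f. if m = k then Poly_Mapping.lookup f k else 0)"
    unfolding lookup_sum by (rule sum.cong) (auto simp: lookup_single when_def)
  also have "\<dots> = Poly_Mapping.lookup f k"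
    by (simp add: in_keys_iff)
  finally show "Poly_Mapping.lookup f k = Poly_Mapping.lookup
     (\<Sum>m\<in>Poly_Mapping.keys f. Poly_Mapping.single m (Poly_Mapping.lookup f m)) k" by simp
qed

lemma Const_mult_single [simp]:
  "Const c * Poly_Mapping.single m d = Poly_Mapping.single m (c * (d::'a::semiring_0))"
  by (simp add: Const_def mult_single)

interpretation Const: ring_morphism "Const :: 'a::comm_ring_1 \<Rightarrow> ('v, 'a) mpoly"
  by unfold_locales (simp_all add: Const_def single_add mult_single)

lemma Const_0 [simp]: "Const 0 = 0"
  by (simp add: Const_def)

lemma Const_1 [simp]: "Const 1 = 1"
  by (simp add: Const_def)

lemma Const_eq_0_iff [simp]: "Const c = 0 \<longleftrightarrow> c = 0"
  unfolding Const_def by (metis lookup_single_eq lookup_zero single_zero)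

lemma single_eq_power_product:
  fixes m :: "'v \<Rightarrow>\<^sub>0 nat" and c :: "'a::comm_ring_1"
  shows "Poly_Mapping.single m c = Const c * power_product Var m"
proof -
  have p: "Var v ^ k = (Poly_Mapping.single (Poly_Mapping.single v k) 1 :: ('v, 'a) mpoly)" for v :: 'v and k
    by (induction k) (simp_all add: Var_def mult_single flip: single_add)
  have q: "finite S \<Longrightarrow> (\<Prod>v\<in>S. Var v ^ Poly_Mapping.lookup m v) =
     (Poly_Mapping.single (\<Sum>v\<in>S. Poly_Mapping.single v (Poly_Mapping.lookup m v)) 1 :: ('v, 'a) mpoly)" for S
    by (induction S rule: finite_induct) (simp_all add: p mult_single)
  have "power_product Var m = (Poly_Mapping.single m 1 :: ('v, 'a) mpoly)"
    unfolding power_product_def using q[of "Poly_Mapping.keys m"]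
    by (simp flip: sum_single_lookup)
  then show ?thesis by simp
qed

lemma mpoly_induct [case_names Const Var add mult]:
  fixes f :: "('v, 'a::comm_ring_1) mpoly"
  assumes "\<And>c. P (Const c)" "\<And>v. P (Var v)"
    and "\<And>f g. P f \<Longrightarrow> P g \<Longrightarrow> P (f + g)" "\<And>f g. P f \<Longrightarrow> P g \<Longrightarrow> P (f * g)"
  shows "P f"
proof -
  have P0: "P 0" and P1: "P 1" using assms(1)[of 0] assms(1)[of 1] by simp_all
  have pow: "P (Var v ^ k)" for v k
    by (induction k) (auto intro: P1 assms)
  have "P (\<Prod>v\<in>S. Var v ^ e v)" for S :: "'v set" and e
    by (induction S rule: infinite_finite_induct) (auto intro: P1 assms pow)
  then have "P (Poly_Mapping.single m c)" for m c
    unfolding single_eq_power_product power_product_def by (intro assms)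
  then have "P (\<Sum>m\<in>S. Poly_Mapping.single m (c m))" for S and c :: "_ \<Rightarrow> 'a"
    by (induction S rule: infinite_finite_induct) (auto intro: P0 assms)
  then show ?thesis by (subst sum_single_lookup)
qed

lemma ring_morphism_eqI:
  fixes h1 h2 :: "('v, 'a::comm_ring_1) mpoly \<Rightarrow> 's::comm_ring_1"
  assumes "ring_morphism h1" "ring_morphism h2"
    and "\<And>c. h1 (Const c) = h2 (Const c)" "\<And>v. h1 (Var v) = h2 (Var v)"
  shows "h1 f = h2 f"
proof -
  interpret h1: ring_morphism h1 by fact
  interpret h2: ring_morphism h2 by fact
  show ?thesis
    by (induction f rule: mpoly_induct) (simp_all add: assms h1.add h2.add h1.mult h2.mult)
qed

text \<open>Evaluation in an arbitrary commutative ring, with the coefficients transported along \<open>\<kappa>\<close>. It gives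
  substitution as the case of \<open>Const\<close>, and it is also needed with values in polynomials over a
  field of fractions.\<close>
definition mpoly_eval ::
  "('a::comm_ring_1 \<Rightarrow> 's::comm_ring_1) \<Rightarrow> ('v \<Rightarrow> 's) \<Rightarrow> ('v, 'a) mpoly \<Rightarrow> 's" where
  "mpoly_eval \<kappa> b f = (\<Sum>m\<in>Poly_Mapping.keys f. \<kappa> (Poly_Mapping.lookup f m) * power_product b m)"

lemma subst_eq_mpoly_eval: "subst b = mpoly_eval Const b"
  by (rule ext) (simp add: subst_def mpoly_eval_def)

context ring_morphism
begin

lemma mpoly_eval_single: "mpoly_eval h b (Poly_Mapping.single m c) = h c * power_product b m"
  by (simp add: mpoly_eval_def zero)

lemma mpoly_eval_superset:
  assumes "finite S" "Poly_Mapping.keys f \<subseteq> S"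
  shows "mpoly_eval h b f = (\<Sum>m\<in>S. h (Poly_Mapping.lookup f m) * power_product b m)"
  unfolding mpoly_eval_def
  by (rule sum.mono_neutral_left) (use assms in \<open>auto simp: in_keys_iff zero\<close>)

lemma mpoly_eval_add: "mpoly_eval h b (f + g) = mpoly_eval h b f + mpoly_eval h b g"
proof -
  let ?S = "Poly_Mapping.keys f \<union> Poly_Mapping.keys g"
  have "Poly_Mapping.keys (f + g) \<subseteq> ?S" by (rule Poly_Mapping.keys_add)
  then show ?thesis
    by (subst (1 2 3) mpoly_eval_superset[where S = ?S])
       (auto simp: lookup_add add distrib_right sum.distrib)
qed

lemma mpoly_eval_sum: "mpoly_eval h b (sum f A) = (\<Sum>i\<in>A. mpoly_eval h b (f i))"
  by (induction A rule: infinite_finite_induct) (simp_all add: mpoly_eval_add, simp_all add: mpoly_eval_def)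

lemma ring_morphism_mpoly_eval:
  fixes b :: "'v \<Rightarrow> 's"
  shows "ring_morphism (mpoly_eval h b)"
proof
  fix f g :: "('v, 'r) mpoly"
  show "mpoly_eval h b (f + g) = mpoly_eval h b f + mpoly_eval h b g" by (rule mpoly_eval_add)
  show "mpoly_eval h b (f * g) = mpoly_eval h b f * mpoly_eval h b g"
  proof -
    have "mpoly_eval h b (f * g) = mpoly_eval h b
      ((\<Sum>m\<in>Poly_Mapping.keys f. Poly_Mapping.single m (Poly_Mapping.lookup f m)) *
       (\<Sum>n\<in>Poly_Mapping.keys g. Poly_Mapping.single n (Poly_Mapping.lookup g n)))"
      by (simp flip: sum_single_lookup)
    also have "\<dots> = mpoly_eval h b f * mpoly_eval h b g"
      by (simp add: sum_product mpoly_eval_sum mult_single mpoly_eval_single mult power_product_add)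
         (simp add: mpoly_eval_def sum_product ac_simps)
    finally show ?thesis .
  qed
  show "mpoly_eval h b 1 = (1::'s)"
    using mpoly_eval_single[of b 0 1] by (simp add: one)
qed

lemma mpoly_eval_Const: "mpoly_eval h b (Const c) = h c"
  using mpoly_eval_single[of b 0 c] by (simp add: Const_def)

lemma mpoly_eval_Var: "mpoly_eval h b (Var v) = b v"
  using mpoly_eval_single[of b "Poly_Mapping.single v 1" 1] by (simp add: Var_def one)

end

interpretation subst: ring_morphism "subst b"
  unfolding subst_eq_mpoly_eval by (rule Const.ring_morphism_mpoly_eval)

lemma subst_Const [simp]: "subst b (Const c) = Const c"
  unfolding subst_eq_mpoly_eval by (rule Const.mpoly_eval_Const)

lemma subst_Var [simp]: "subst b (Var v) = b v"
  unfolding subst_eq_mpoly_eval by (rule Const.mpoly_eval_Var)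

lemma subst_single: "subst b (Poly_Mapping.single m c) = Const c * power_product b m"
  unfolding subst_eq_mpoly_eval by (rule Const.mpoly_eval_single)

section \<open>The graded reverse lexicographic order on three variables\<close>

lemma UNIV_xyz: "UNIV = {X, Y, Z}"
  using xyz.exhaust by auto

lemma finite_xyz: "finite (UNIV :: xyz set)"
  by (simp add: UNIV_xyz)

abbreviation expo :: "('v \<Rightarrow>\<^sub>0 nat) \<Rightarrow> 'v \<Rightarrow> nat" where "expo \<equiv> Poly_Mapping.lookup"

lemma xyz_exponent_eqI:
  "expo m X = expo n X \<Longrightarrow> expo m Y = expo n Y \<Longrightarrow> expo m Z = expo n Z \<Longrightarrow> m = n"
  by (rule poly_mapping_eqI) (metis xyz.exhaust)

lemma total_degree_xyz: "total_degree m = expo m X + expo m Y + expo m Z"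
proof -
  have "total_degree m = (\<Sum>v\<in>UNIV. expo m v)"
    unfolding total_degree_def
    by (rule sum.mono_neutral_left) (simp_all add: in_keys_iff finite_xyz)
  then show ?thesis by (simp add: UNIV_xyz)
qed

lemma total_degree_add: "total_degree (m + n) = total_degree m + total_degree (n :: xyz \<Rightarrow>\<^sub>0 nat)"
  by (simp add: total_degree_xyz lookup_add)

lemma less_xyz_simps [simp]: "X < Y" "X < Z" "Y < Z" "\<not> Y < X" "\<not> Z < X" "\<not> Z < Y" "\<not> (v::xyz) < v"
  by (simp_all add: less_xyz_def less_eq_xyz_def)

lemma grevlex_less_iff:
  "grevlex_less m n \<longleftrightarrow> total_degree m < total_degree n \<or> total_degree m = total_degree n \<and>
     (expo n X < expo m X \<or> expo n X = expo m X \<and> expo n Y < expo m Y)"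
proof -
  have ex: "(\<exists>v. Q v) \<longleftrightarrow> Q X \<or> Q Y \<or> Q Z" for Q by (metis xyz.exhaust)
  have al: "(\<forall>v. Q v) \<longleftrightarrow> Q X \<and> Q Y \<and> Q Z" for Q by (metis xyz.exhaust)
  show ?thesis
    unfolding grevlex_less_def ex al by (auto simp: total_degree_xyz)
qed

lemma grevlex_less_irrefl: "\<not> grevlex_less m (m :: xyz \<Rightarrow>\<^sub>0 nat)"
  by (simp add: grevlex_less_iff)

lemma grevlex_less_trans:
  "grevlex_less k m \<Longrightarrow> grevlex_less m n \<Longrightarrow> grevlex_less k (n :: xyz \<Rightarrow>\<^sub>0 nat)"
  by (auto simp: grevlex_less_iff)

lemma grevlex_less_linear: "grevlex_less m n \<or> m = n \<or> grevlex_less n (m :: xyz \<Rightarrow>\<^sub>0 nat)"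
proof -
  have "m = n" if "\<not> grevlex_less m n" "\<not> grevlex_less n m"
    by (rule xyz_exponent_eqI) (use that in \<open>auto simp: grevlex_less_iff total_degree_xyz\<close>)
  then show ?thesis by blast
qed

lemma grevlex_less_add_right:
  "grevlex_less (m + k) (n + k) \<longleftrightarrow> grevlex_less m (n :: xyz \<Rightarrow>\<^sub>0 nat)"
  by (auto simp: grevlex_less_iff lookup_add total_degree_add)

text \<open>On exponents \<open>(i, j, k)\<close> of \<open>(x, y, z)\<close> the order is the lexicographic order of
  \<open>(i + j + k, j + k, k)\<close>.\<close>
lemma wf_grevlex_less: "wf {(m, n :: xyz \<Rightarrow>\<^sub>0 nat). grevlex_less m n}"
proof (rule wf_subset)
  show "wf (inv_image (less_than <*lex*> less_than <*lex*> less_than)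
     (\<lambda>m :: xyz \<Rightarrow>\<^sub>0 nat. (total_degree m, expo m Y + expo m Z, expo m Z)))"
    by auto
  show "{(m, n :: xyz \<Rightarrow>\<^sub>0 nat). grevlex_less m n} \<subseteq> inv_image (less_than <*lex*> less_than <*lex*> less_than)
     (\<lambda>m :: xyz \<Rightarrow>\<^sub>0 nat. (total_degree m, expo m Y + expo m Z, expo m Z))"
    by (auto simp: grevlex_less_iff total_degree_xyz)
qed

section \<open>Lead exponents\<close>

definition keys_below :: "(xyz \<Rightarrow>\<^sub>0 nat) \<Rightarrow> (xyz, 'a::zero) mpoly \<Rightarrow> bool" where
  "keys_below e f \<longleftrightarrow> (\<forall>m\<in>Poly_Mapping.keys f. grevlex_less m e)"

lemma keys_below_add: "keys_below e f \<Longrightarrow> keys_below e g \<Longrightarrow> keys_below e (f + g)"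
  using Poly_Mapping.keys_add[of f g] by (auto simp: keys_below_def)

lemma keys_below_sum:
  "(\<And>i. i \<in> S \<Longrightarrow> keys_below e (f i)) \<Longrightarrow> keys_below e (sum f S)"
  by (induction S rule: infinite_finite_induct) (auto intro: keys_below_add, simp_all add: keys_below_def)

lemma keys_below_uminus: "keys_below e f \<Longrightarrow> keys_below e (- f :: (xyz, 'a::ab_group_add) mpoly)"
  by (auto simp: keys_below_def in_keys_iff)

lemma keys_below_single: "keys_below e (Poly_Mapping.single m c) \<longleftrightarrow> c = 0 \<or> grevlex_less m e"
  by (simp add: keys_below_def)

lemma keys_below_trans: "keys_below e f \<Longrightarrow> grevlex_less e e' \<Longrightarrow> keys_below e' f"
  by (auto simp: keys_below_def intro: grevlex_less_trans)

lemma keys_below_mult: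
  assumes "keys_below e f" "keys_below e' g"
  shows "keys_below (e + e') (f * g)"
  unfolding keys_below_def
proof
  fix m assume "m \<in> Poly_Mapping.keys (f * g)"
  with keys_mult[of f g] obtain a b where ab: "m = a + b" "a \<in> Poly_Mapping.keys f" "b \<in> Poly_Mapping.keys g"
    by auto
  with assms have "grevlex_less a e" "grevlex_less b e'" by (auto simp: keys_below_def)
  then have "grevlex_less (a + b) (e + b)" "grevlex_less (b + e) (e' + e)"
    by (simp_all add: grevlex_less_add_right)
  then show "grevlex_less m (e + e')"
    unfolding ab by (metis add.commute grevlex_less_trans)
qed

text \<open>Unlike in the preceding lemma, one factor may attain its bound; strictness of the other
  suffices.\<close>
lemma keys_below_mult_single:
  assumes "keys_below e f"
  shows "keys_below (e + e') (f * Poly_Mapping.single e' c)"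
  unfolding keys_below_def
proof
  fix m assume "m \<in> Poly_Mapping.keys (f * Poly_Mapping.single e' c)"
  with keys_mult[of f "Poly_Mapping.single e' c"]
  obtain a where ab: "m = a + e'" "a \<in> Poly_Mapping.keys f"
    by (auto split: if_splits)
  with assms show "grevlex_less m (e + e')"
    by (auto simp: keys_below_def grevlex_less_add_right)
qed

lemma lead_exp_eqI:
  assumes "f = Poly_Mapping.single e c + r" "c \<noteq> 0" "keys_below e r"
  shows "lead_exp f = e" "Poly_Mapping.lookup f e = c"
proof -
  have "Poly_Mapping.lookup r e = 0"
    using assms(3) grevlex_less_irrefl[of e] by (metis in_keys_iff keys_below_def)
  then show l: "Poly_Mapping.lookup f e = c" by (simp add: assms lookup_add)
  have below: "grevlex_less n e" if "n \<in> Poly_Mapping.keys f" "n \<noteq> e" for n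
    using that Poly_Mapping.keys_add[of "Poly_Mapping.single e c" r] assms
    by (auto simp: keys_below_def split: if_splits)
  have e: "e \<in> Poly_Mapping.keys f" using l assms(2) by (simp add: in_keys_iff)
  show "lead_exp f = e"
    unfolding lead_exp_def
  proof (rule the_equality)
    fix m assume "m \<in> Poly_Mapping.keys f \<and> (\<forall>n\<in>Poly_Mapping.keys f. n \<noteq> m \<longrightarrow> grevlex_less n m)"
    then show "m = e"
      using below[of m] e grevlex_less_trans[of m e m] grevlex_less_irrefl[of m] by metis
  qed (use below e in blast)
qed

lemma finite_grevlex_maximum:
  assumes "finite S" "S \<noteq> {}"
  shows "\<exists>m\<in>S. \<forall>n\<in>S. n \<noteq> m \<longrightarrow> grevlex_less n (m :: xyz \<Rightarrow>\<^sub>0 nat)"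
  using assms
proof (induction S rule: finite_ne_induct)
  case (insert k S)
  then obtain m where m: "m \<in> S" "\<forall>n\<in>S. n \<noteq> m \<longrightarrow> grevlex_less n m" by blast
  show ?case
  proof (cases "grevlex_less m k")
    case True
    with m show ?thesis by (intro bexI[of _ k]) (auto intro: grevlex_less_trans)
  next
    case False
    with grevlex_less_linear[of m k] m show ?thesis by (intro bexI[of _ m]) auto
  qed
qed auto

lemma lead_exp_decomposition:
  fixes f :: "(xyz, 'a::ab_group_add) mpoly"
  assumes "f \<noteq> 0"
  obtains r where "f = Poly_Mapping.single (lead_exp f) (Poly_Mapping.lookup f (lead_exp f)) + r"
    "keys_below (lead_exp f) r" "Poly_Mapping.lookup f (lead_exp f) \<noteq> 0"
proof -
  have "Poly_Mapping.keys f \<noteq> {}" using assms by simp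
  then obtain m where m: "m \<in> Poly_Mapping.keys f" "\<forall>n\<in>Poly_Mapping.keys f. n \<noteq> m \<longrightarrow> grevlex_less n m"
    using finite_grevlex_maximum[of "Poly_Mapping.keys f"] by auto
  define r where "r = f - Poly_Mapping.single m (Poly_Mapping.lookup f m)"
  have f: "f = Poly_Mapping.single m (Poly_Mapping.lookup f m) + r" by (simp add: r_def)
  have "keys_below m r"
    unfolding keys_below_def
  proof
    fix n assume n: "n \<in> Poly_Mapping.keys r"
    then have "n \<noteq> m" by (auto simp: r_def in_keys_iff lookup_minus)
    with n have "n \<in> Poly_Mapping.keys f" by (auto simp: r_def in_keys_iff lookup_minus lookup_single)
    with m \<open>n \<noteq> m\<close> show "grevlex_less n m" by blast
  qed
  moreover have nz: "Poly_Mapping.lookup f m \<noteq> 0" using m by (simp add: in_keys_iff)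
  ultimately have "lead_exp f = m" using lead_exp_eqI(1) f by blast
  with that f \<open>keys_below m r\<close> nz show thesis by metis
qed

lemma lead_exp_mult:
  fixes f g :: "(xyz, 'a::field) mpoly"
  assumes "f \<noteq> 0" "g \<noteq> 0"
  shows "lead_exp (f * g) = lead_exp f + lead_exp g"
    and "Poly_Mapping.lookup (f * g) (lead_exp f + lead_exp g) =
         Poly_Mapping.lookup f (lead_exp f) * Poly_Mapping.lookup g (lead_exp g)"
proof -
  obtain r where f: "f = Poly_Mapping.single (lead_exp f) (Poly_Mapping.lookup f (lead_exp f)) + r"
    "keys_below (lead_exp f) r" "Poly_Mapping.lookup f (lead_exp f) \<noteq> 0"
    using lead_exp_decomposition[OF assms(1)] .
  obtain s where g: "g = Poly_Mapping.single (lead_exp g) (Poly_Mapping.lookup g (lead_exp g)) + s"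
    "keys_below (lead_exp g) s" "Poly_Mapping.lookup g (lead_exp g) \<noteq> 0"
    using lead_exp_decomposition[OF assms(2)] .
  let ?c = "Poly_Mapping.lookup f (lead_exp f)" and ?d = "Poly_Mapping.lookup g (lead_exp g)"
  let ?f = "Poly_Mapping.single (lead_exp f) ?c" and ?g = "Poly_Mapping.single (lead_exp g) ?d"
  have "f * g = (?f + r) * (?g + s)" using f(1) g(1) by simp
  also have "\<dots> = Poly_Mapping.single (lead_exp f + lead_exp g) (?c * ?d) + (s * ?f + r * ?g + r * s)"
    by (simp add: algebra_simps mult_single)
  finally have fg: "f * g = \<dots>" .
  have "keys_below (lead_exp f + lead_exp g) (s * ?f + r * ?g + r * s)"
    using keys_below_mult_single[OF g(2), of "lead_exp f" ?c]
      keys_below_mult_single[OF f(2), of "lead_exp g" ?d] keys_below_mult[OF f(2) g(2)]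
    by (intro keys_below_add) (simp_all add: add.commute)
  from lead_exp_eqI[OF fg _ this] f(3) g(3)
  show "lead_exp (f * g) = lead_exp f + lead_exp g"
    "Poly_Mapping.lookup (f * g) (lead_exp f + lead_exp g) = ?c * ?d" by auto
qed

section \<open>Polynomials invariant under a finite group of translations\<close>

text \<open>Distinct roots can be split off one after the other, since over a domain a root of a product is
  a root of one of the factors.\<close>
lemma prod_linear_factors_dvd:
  fixes Q :: "'r::idom poly"
  assumes "finite V" "\<And>v. v \<in> V \<Longrightarrow> poly Q v = 0"
  shows "(\<Prod>v\<in>V. [:- v, 1:]) dvd Q"
  using assms
proof (induction V arbitrary: Q rule: finite_induct)
  case (insert v V)
  then obtain Q' where Q': "Q = [:- v, 1:] * Q'"
    by (metis dvd_def insertI1 poly_eq_0_iff_dvd)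
  have "poly Q' w = 0" if "w \<in> V" for w
    using insert.prems[of w] insert.hyps that by (auto simp: Q')
  then have "(\<Prod>v\<in>V. [:- v, 1:]) dvd Q'" by (rule insert.IH)
  then show ?case unfolding Q' prod.insert[OF insert.hyps] by (intro mult_dvd_mono) simp_all
qed simp

lemma degree_prod_linear_factors:
  fixes V :: "'r::idom set"
  shows "degree (\<Prod>v\<in>V. [:- v, 1:]) = card V" "lead_coeff (\<Prod>v\<in>V. [:- v, 1:]) = 1"
proof -
  show "degree (\<Prod>v\<in>V. [:- v, 1:]) = card V"
    by (subst degree_prod_sum_eq) auto
  show "lead_coeff (\<Prod>v\<in>V. [:- v, 1:]) = 1"
    by (simp add: lead_coeff_prod)
qed

lemma monic_eq_prod_linear_factors:
  fixes Q :: "'r::idom poly"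
  assumes "finite V" "\<And>v. v \<in> V \<Longrightarrow> poly Q v = 0" "degree Q = card V" "lead_coeff Q = 1"
  shows "Q = (\<Prod>v\<in>V. [:- v, 1:])"
proof -
  let ?N = "\<Prod>v\<in>V. [:- v, 1:]"
  obtain k where k: "Q = ?N * k"
    using prod_linear_factors_dvd[OF assms(1,2)] by (auto simp: dvd_def)
  with assms have "k \<noteq> 0" "?N \<noteq> 0" by auto
  then have "degree Q = card V + degree k"
    unfolding k by (simp add: degree_mult_eq degree_prod_linear_factors)
  with assms have "degree k = 0" by simp
  then obtain c where c: "k = [:c:]" by (metis degree_eq_zeroE)
  have "lead_coeff k = 1"
    using assms(4) lead_coeff_mult[of ?N k] degree_prod_linear_factors(2)[of V] k by (metis mult_1)
  with c k show ?thesis by simp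
qed

text \<open>An invariant \<open>Q\<close> takes the same value at all points of \<open>V\<close>, so \<open>Q - Q(0)\<close> is divisible by the norm
  of the variable; the quotient is again invariant, because the norm is, and has smaller degree.\<close>
lemma translation_invariant_poly:
  fixes V :: "'r::idom set" and Q :: "'r poly"
  assumes V: "finite V" "0 \<in> V" "\<And>v w. v \<in> V \<Longrightarrow> w \<in> V \<Longrightarrow> v + w \<in> V"
    and Q: "\<And>v. v \<in> V \<Longrightarrow> pcompose Q [:v, 1:] = Q"
  shows "\<exists>q. Q = pcompose q (\<Prod>v\<in>V. [:- v, 1:])"
  using Q
proof (induction "degree Q" arbitrary: Q rule: less_induct)
  case less
  let ?N = "\<Prod>v\<in>V. [:- v, 1:]"
  have N0: "?N \<noteq> 0" using V(1) by simp
  have N: "pcompose ?N [:v, 1:] = ?N" if v: "v \<in> V" for v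
  proof -
    have "(\<lambda>w. w + v) ` V = V"
      by (rule endo_inj_surj) (use V v in auto)
    then have "?N = (\<Prod>w\<in>V. [:- (w + v), 1:])"
      using prod.reindex[of "\<lambda>w. w + v" V "\<lambda>w. [:- w, 1:]"] by simp
    then have "pcompose ?N [:v, 1:] = (\<Prod>w\<in>V. pcompose [:- (w + v), 1:] [:v, 1:])"
      by (simp add: pcompose_prod)
    also have "\<dots> = ?N" by (simp add: pcompose_pCons)
    finally show ?thesis .
  qed
  let ?c = "poly Q 0"
  show ?case
  proof (cases "degree Q = 0")
    case True
    then obtain c where "Q = [:c:]" by (metis degree_eq_zeroE)
    then show ?thesis by (intro exI[of _ "[:c:]"]) simp
  next
    case False
    have "poly (Q - [:?c:]) v = 0" if "v \<in> V" for v
      using arg_cong[OF less.prems[OF that], of "\<lambda>q. poly q 0"] by (simp add: poly_pcompose)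
    with prod_linear_factors_dvd[OF V(1), of "Q - [:?c:]"] obtain Q1 where Q1: "Q - [:?c:] = ?N * Q1"
      by (auto simp: dvd_def)
    have d: "degree (Q - [:?c:]) = degree Q"
    proof -
      have "Q - [:?c:] = Q + [:- ?c:]" by simp
      then show ?thesis using False by (simp only: degree_add_eq_left degree_pCons_0)
    qed
    with False Q1 have "Q1 \<noteq> 0" by auto
    with N0 Q1 d have "degree Q = card V + degree Q1"
      by (metis degree_mult_eq degree_prod_linear_factors(1))
    moreover have "card V > 0" using V by (auto simp: card_gt_0_iff)
    ultimately have "degree Q1 < degree Q" by simp
    moreover have "pcompose Q1 [:v, 1:] = Q1" if v: "v \<in> V" for v
    proof -
      have "?N * pcompose Q1 [:v, 1:] = pcompose (?N * Q1) [:v, 1:]"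
        by (simp add: pcompose_mult N[OF v])
      also have "\<dots> = ?N * Q1"
        unfolding Q1[symmetric] by (simp add: pcompose_diff less.prems[OF v])
      finally show ?thesis using N0 by simp
    qed
    ultimately obtain q where "Q1 = pcompose q ?N" using less.hyps by blast
    then have "Q = pcompose (pCons ?c q) ?N"
      using Q1 by (simp add: pcompose_pCons algebra_simps)
    then show ?thesis by blast
  qed
qed

text \<open>Translation by \<open>a\<close> is injective on the finite set, hence surjective, so \<open>0\<close> is attained.\<close>
lemma finite_additive_uminus:
  fixes A :: "'a::ab_group_add set"
  assumes "finite A" "0 \<in> A" "\<And>a b. a \<in> A \<Longrightarrow> b \<in> A \<Longrightarrow> a + b \<in> A" "a \<in> A"
  shows "- a \<in> A"
proof -
  have "(\<lambda>w. w + a) ` A = A"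
    by (rule endo_inj_surj) (use assms in auto)
  with assms(2) obtain w where "w \<in> A" "0 = w + a" by (metis imageE)
  then show ?thesis by (metis add.commute minus_unique)
qed

context ring_morphism
begin

definition eval_poly :: "'s \<Rightarrow> 'r poly \<Rightarrow> 's" where
  "eval_poly y g = poly (map_poly h g) y"

lemma eval_poly_pCons [simp]: "eval_poly y (pCons a g) = h a + y * eval_poly y g"
  by (simp add: eval_poly_def map_poly_pCons zero)

lemma eval_poly_0 [simp]: "eval_poly y 0 = 0"
  by (simp add: eval_poly_def)

lemma eval_poly_add: "eval_poly y (f + g) = eval_poly y f + eval_poly y g"
  by (induction f g rule: poly_induct2) (simp_all add: add algebra_simps)

lemma eval_poly_monom: "eval_poly y (monom a n) = h a * y ^ n"
  by (induction n) (simp_all add: monom_0 monom_Suc zero ac_simps)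

lemma eval_poly_smult: "eval_poly y (smult a g) = h a * eval_poly y g"
  by (induction g) (simp_all add: mult algebra_simps)

lemma ring_morphism_eval_poly: "ring_morphism (eval_poly y)"
proof
  show "eval_poly y (f + g) = eval_poly y f + eval_poly y g" for f g by (rule eval_poly_add)
  show "eval_poly y (f * g) = eval_poly y f * eval_poly y g" for f g
    by (induction f) (simp_all add: eval_poly_add eval_poly_smult zero algebra_simps)
  show "eval_poly y 1 = 1" by (simp add: one_pCons one)
qed

lemma eval_poly_pcompose: "eval_poly y (pcompose f g) = eval_poly (eval_poly y g) f"
proof -
  interpret e: ring_morphism "eval_poly y" by (rule ring_morphism_eval_poly)
  show ?thesis by (induction f) (simp_all add: pcompose_pCons e.add e.mult)
qed

lemma eval_poly_altdef: "eval_poly y g = (\<Sum>k\<le>degree g. h (coeff g k) * y ^ k)"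
proof -
  have "degree (map_poly h g) \<le> degree g"
    by (rule degree_le) (simp add: coeff_map_poly zero coeff_eq_0)
  then have "eval_poly y g = (\<Sum>k\<le>degree g. coeff (map_poly h g) k * y ^ k)"
    unfolding eval_poly_def poly_altdef
    by (intro sum.mono_neutral_left) (auto simp: coeff_eq_0)
  then show ?thesis by (simp add: coeff_map_poly zero)
qed

end

section \<open>SAGBI bases and subduction\<close>

definition monic :: "(xyz, 'a::field) mpoly \<Rightarrow> bool" where
  "monic f \<longleftrightarrow> Poly_Mapping.lookup f (lead_exp f) = 1"

lemma monic_nonzero: "monic f \<Longrightarrow> f \<noteq> 0"
  by (auto simp: monic_def)

lemma monic_1: "monic (1 :: (xyz, 'a::field) mpoly)" and lead_exp_1: "lead_exp (1 :: (xyz, 'a::field) mpoly) = 0"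
  using lead_exp_eqI[of "1 :: (xyz, 'a) mpoly" 0 1 0]
  by (auto simp: monic_def keys_below_def lookup_one)

lemma monic_mult:
  assumes "monic f" "monic g"
  shows "monic (f * g)" "lead_exp (f * g) = lead_exp f + lead_exp g"
  using lead_exp_mult[of f g] monic_nonzero[OF assms(1)] monic_nonzero[OF assms(2)] assms
  by (auto simp: monic_def)

lemma monic_power:
  assumes "monic f"
  shows "monic (f ^ n) \<and> (\<forall>v. expo (lead_exp (f ^ n)) v = n * expo (lead_exp f) v)"
  by (induction n) (use assms in \<open>auto simp: monic_1 lead_exp_1 monic_mult lookup_add\<close>)

lemma monic_prod:
  assumes "\<And>i. i \<in> S \<Longrightarrow> monic (f i)"
  shows "monic (prod f S) \<and> (\<forall>v. expo (lead_exp (prod f S)) v = (\<Sum>i\<in>S. expo (lead_exp (f i)) v))"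
  using assms
  by (induction S rule: infinite_finite_induct) (auto simp: monic_1 lead_exp_1 monic_mult lookup_add)

lemma monic_power_product:
  fixes b :: "'i::finite \<Rightarrow> (xyz, 'a::field) mpoly"
  assumes "\<And>i. monic (b i)"
  shows "monic (power_product b I)"
    "expo (lead_exp (power_product b I)) v = (\<Sum>i\<in>UNIV. expo I i * expo (lead_exp (b i)) v)"
proof -
  have "power_product b I = (\<Prod>i\<in>UNIV. b i ^ expo I i)"
    by (rule power_product_superset) auto
  with monic_prod[of UNIV "\<lambda>i. b i ^ expo I i"] monic_power[OF assms]
  show "monic (power_product b I)"
    "expo (lead_exp (power_product b I)) v = (\<Sum>i\<in>UNIV. expo I i * expo (lead_exp (b i)) v)"
    by auto
qed

text \<open>When the products have pairwise distinct lead monomials, the largest of these occurs in only one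
  of them and cannot be cancelled.\<close>
lemma lead_exp_subst:
  fixes b :: "'i \<Rightarrow> (xyz, 'a::field) mpoly" and q :: "('i, 'a) mpoly"
  assumes b: "\<And>I. monic (power_product b I)"
    and inj: "inj_on (\<lambda>I. lead_exp (power_product b I)) (Poly_Mapping.keys q)"
    and q: "q \<noteq> 0"
  obtains I where "I \<in> Poly_Mapping.keys q" "subst b q \<noteq> 0"
    "lead_exp (subst b q) = lead_exp (power_product b I)"
proof -
  let ?K = "Poly_Mapping.keys q" and ?e = "\<lambda>I. lead_exp (power_product b I)"
  have "?e ` ?K \<noteq> {}" using q by simp
  from finite_grevlex_maximum[OF _ this]
  obtain I where I: "I \<in> ?K" "\<And>J. J \<in> ?K \<Longrightarrow> ?e J \<noteq> ?e I \<Longrightarrow> grevlex_less (?e J) (?e I)"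
    by auto
  let ?c = "Poly_Mapping.lookup q"
  have pp: "\<exists>r. power_product b J = Poly_Mapping.single (?e J) 1 + r \<and> keys_below (?e J) r" for J
    using lead_exp_decomposition[OF monic_nonzero[OF b[of J]]] b[of J] unfolding monic_def by metis
  then obtain r where r: "power_product b I = Poly_Mapping.single (?e I) 1 + r" "keys_below (?e I) r"
    by blast
  have Cr: "keys_below e (Const c * s)" if "keys_below e s" for e c and s :: "(xyz, 'a) mpoly"
    using keys_below_mult_single[OF that, of 0 c] by (simp add: Const_def mult.commute)
  have "subst b q = Const (?c I) * power_product b I + (\<Sum>J\<in>?K - {I}. Const (?c J) * power_product b J)"
    unfolding subst_def by (rule sum.remove) (use I in auto)
  also have "\<dots> = Poly_Mapping.single (?e I) (?c I) +
      (Const (?c I) * r + (\<Sum>J\<in>?K - {I}. Const (?c J) * power_product b J))"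
    using arg_cong[OF r(1), of "\<lambda>s. Const (?c I) * s"] by (simp add: distrib_left)
  finally have eq: "subst b q = \<dots>" .
  have "keys_below (?e I) (Const (?c I) * r + (\<Sum>J\<in>?K - {I}. Const (?c J) * power_product b J))"
  proof (intro keys_below_add keys_below_sum Cr r)
    fix J assume J: "J \<in> ?K - {I}"
    with inj I(1) have "?e J \<noteq> ?e I" by (auto simp: inj_on_def)
    with I(2) J have less: "grevlex_less (?e J) (?e I)" by blast
    obtain s where s: "power_product b J = Poly_Mapping.single (?e J) 1 + s" "keys_below (?e J) s"
      using pp by blast
    have "keys_below (?e I) (Poly_Mapping.single (?e J) 1 + s)"
      using less by (intro keys_below_add keys_below_trans[OF s(2) less]) (simp add: keys_below_single)
    then show "keys_below (?e I) (power_product b J)"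
      by (subst s(1))
  qed
  from lead_exp_eqI[OF eq _ this] I(1)
  have "lead_exp (subst b q) = ?e I" "Poly_Mapping.lookup (subst b q) (?e I) \<noteq> 0"
    by (auto simp: in_keys_iff)
  then show thesis using that[OF I(1)] by (metis lookup_zero)
qed

text \<open>The SAGBI property for the family \<open>b\<close>, on the level of exponents: the lead exponent of a product is
  the corresponding sum of the lead exponents of its factors.\<close>
definition lead_exps_generated ::
  "('i \<Rightarrow> (xyz, 'a::field) mpoly) \<Rightarrow> (xyz, 'a) mpoly set \<Rightarrow> bool" where
  "lead_exps_generated b A \<longleftrightarrow> (\<forall>f\<in>A. f \<noteq> 0 \<longrightarrow> (\<exists>I. lead_exp f = lead_exp (power_product b I)))"

lemma subalgebra_Const: "subalgebra A \<Longrightarrow> Const c \<in> A"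
  and subalgebra_add: "subalgebra A \<Longrightarrow> f \<in> A \<Longrightarrow> g \<in> A \<Longrightarrow> f + g \<in> A"
  and subalgebra_mult: "subalgebra A \<Longrightarrow> f \<in> A \<Longrightarrow> g \<in> A \<Longrightarrow> f * g \<in> A"
  by (auto simp: subalgebra_def)

lemma subalgebra_power: "subalgebra A \<Longrightarrow> f \<in> A \<Longrightarrow> f ^ n \<in> A"
  using subalgebra_Const[of A 1] by (induction n) (auto intro: subalgebra_mult)

lemma subalgebra_sum: "subalgebra A \<Longrightarrow> (\<And>i. i \<in> S \<Longrightarrow> f i \<in> A) \<Longrightarrow> sum f S \<in> A"
  using subalgebra_Const[of A 0]
  by (induction S rule: infinite_finite_induct) (auto intro: subalgebra_add)

lemma subalgebra_prod: "subalgebra A \<Longrightarrow> (\<And>i. i \<in> S \<Longrightarrow> f i \<in> A) \<Longrightarrow> prod f S \<in> A"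
  using subalgebra_Const[of A 1]
  by (induction S rule: infinite_finite_induct) (auto intro: subalgebra_mult)

lemma subalgebra_power_product:
  "subalgebra A \<Longrightarrow> (\<And>i. b i \<in> A) \<Longrightarrow> power_product b I \<in> A"
  unfolding power_product_def by (intro subalgebra_prod subalgebra_power)

lemma subalgebra_subst: "subalgebra A \<Longrightarrow> (\<And>i. b i \<in> A) \<Longrightarrow> subst b q \<in> A"
  unfolding subst_def
  by (intro subalgebra_sum subalgebra_mult subalgebra_Const subalgebra_power_product)

lemma subalgebra_minus:
  assumes "subalgebra A" "f \<in> A" "g \<in> A"
  shows "f - g \<in> A"
proof -
  have "f + Const (- 1) * g \<in> A"
    by (intro subalgebra_add subalgebra_mult subalgebra_Const assms)
  then show ?thesis by (simp add: Const.uminus)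
qed

lemma subalgebra_hull: "subalgebra (subalgebra hull S)"
  unfolding hull_def subalgebra_def by blast

lemma LM_mult:
  "f \<noteq> 0 \<Longrightarrow> g \<noteq> 0 \<Longrightarrow> LM (f * g) = LM f * LM (g :: (xyz, 'a::field) mpoly)"
  by (simp add: LM_def lead_exp_mult mult_single)

lemma LM_power_product:
  fixes b :: "'i::finite \<Rightarrow> (xyz, 'a::field) mpoly"
  assumes "\<And>i. b i \<noteq> 0"
  shows "LM (power_product b I) = power_product (\<lambda>i. LM (b i)) I"
proof -
  have 1: "LM (1 :: (xyz, 'a) mpoly) = 1" by (simp add: LM_def lead_exp_1)
  have pow: "LM (f ^ n) = LM f ^ n" if "f \<noteq> 0" for f :: "(xyz, 'a) mpoly" and n
    using that by (induction n) (simp_all add: 1 LM_mult)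
  have "finite S \<Longrightarrow> LM (\<Prod>i\<in>S. b i ^ expo I i) = (\<Prod>i\<in>S. LM (b i) ^ expo I i)" for S
    by (induction S rule: finite_induct) (simp_all add: 1 LM_mult pow assms)
  then show ?thesis by (simp add: power_product_superset[of UNIV])
qed

text \<open>Lead monomials are multiplicative, so the linear span of the lead monomials of an algebra is an
  algebra; the hull of the lead monomials of the \<open>b i\<close> is a linear space. Each of the two sides thus
  contains the other as soon as it contains its generators.\<close>
lemma sagbi_basisI:
  fixes b :: "'i::finite \<Rightarrow> (xyz, 'a::field) mpoly"
  assumes A: "subalgebra A" and bA: "\<And>i. b i \<in> A" and b0: "\<And>i. b i \<noteq> 0"
    and gen: "lead_exps_generated b A"
  shows "sagbi_basis (range b) A"
proof -
  let ?scale = "\<lambda>(c::'a) (f::(xyz, 'a) mpoly). Const c * f"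
  interpret module ?scale
    by unfold_locales (simp_all add: algebra_simps Const.add Const.mult)
  let ?span = "module.span ?scale"
  let ?L = "LM ` (A - {0})"
  have bL: "LM ` (range b - {0}) = range (\<lambda>i. LM (b i))" using b0 by auto
  have 1: "1 \<in> A" using subalgebra_Const[OF A, of 1] by simp
  have Lmult: "f * g \<in> ?L" if "f \<in> ?L" "g \<in> ?L" for f g
  proof -
    from that obtain f' g' where "f = LM f'" "g = LM g'" "f' \<in> A" "g' \<in> A" "f' \<noteq> 0" "g' \<noteq> 0" by auto
    then show ?thesis
      by (intro image_eqI[of _ _ "f' * g'"]) (auto simp: LM_mult intro: subalgebra_mult[OF A])
  qed
  have "subalgebra (?span ?L)"
  proof -
    have "LM 1 = (1 :: (xyz, 'a) mpoly)" by (simp add: LM_def lead_exp_1)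
    with 1 have 1: "1 \<in> ?L" by (intro image_eqI[of _ _ 1]) auto
    have "Const c \<in> ?span ?L" for c
      using span_scale[OF span_base[OF 1], of c] by simp
    moreover have "f * g \<in> ?span ?L" if f: "f \<in> ?span ?L" and g: "g \<in> ?span ?L" for f g
    proof -
      have inner: "f * g \<in> ?span ?L" if f: "f \<in> ?L" for f
        using g
      proof (induction rule: span_induct_alt)
        case base show ?case using span_zero by simp
      next
        case (step c g h)
        have "f * (Const c * g + h) = Const c * (f * g) + f * h" by (simp add: algebra_simps)
        with step show ?case
          using span_add[OF span_scale[OF span_base[OF Lmult[OF f step(1)]], of c] step(2)] by simp
      qed
      show ?thesis using f
      proof (induction rule: span_induct_alt)
        case base show ?case using span_zero by simp
      next
        case (step c f h)
        have "(Const c * f + h) * g = Const c * (f * g) + h * g" by (simp add: algebra_simps)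
        with step show ?case
          using span_add[OF span_scale[OF inner[OF step(1)], of c] step(2)] by simp
      qed
    qed
    ultimately show ?thesis using span_add unfolding subalgebra_def by blast
  qed
  moreover have "LM ` (range b - {0}) \<subseteq> ?span ?L"
    unfolding bL using bA b0 by (auto intro!: span_base)
  ultimately have le: "subalgebra hull (LM ` (range b - {0})) \<subseteq> ?span ?L"
    by (intro hull_minimal)
  let ?H = "subalgebra hull (LM ` (range b - {0}))"
  have H: "subalgebra ?H" by (rule subalgebra_hull)
  have "?L \<subseteq> ?H"
  proof
    fix m assume "m \<in> ?L"
    then obtain f where f: "f \<in> A" "f \<noteq> 0" "m = LM f" by auto
    with gen obtain I where "lead_exp f = lead_exp (power_product b I)"
      by (auto simp: lead_exps_generated_def)
    then have "m = power_product (\<lambda>i. LM (b i)) I"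
      using f LM_power_product[of b I, OF b0] by (simp add: LM_def)
    also have "\<dots> \<in> ?H"
      by (rule subalgebra_power_product[OF H]) (use hull_subset[of "LM ` (range b - {0})" subalgebra] bL in auto)
    finally show "m \<in> ?H" .
  qed
  moreover have "subspace ?H"
    by (rule subspaceI)
       (use subalgebra_Const[OF H, of 0] in \<open>auto intro: subalgebra_add[OF H] subalgebra_mult[OF H] subalgebra_Const[OF H]\<close>)
  ultimately have "?span ?L \<subseteq> ?H" by (rule span_minimal)
  with le A bA show ?thesis by (auto simp: sagbi_basis_def)
qed

lemma lead_term_cancel:
  fixes f g :: "(xyz, 'a::field) mpoly"
  assumes "f \<noteq> 0" "g \<noteq> 0" "LT f = LT g"
  shows "lead_exp g = lead_exp f" "keys_below (lead_exp f) (f - g)"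
proof -
  obtain r where r: "f = LT f + r" "keys_below (lead_exp f) r"
    using lead_exp_decomposition[OF assms(1)] unfolding LT_def by metis
  obtain s where s: "g = LT g + s" "keys_below (lead_exp g) s"
    and g0: "Poly_Mapping.lookup g (lead_exp g) \<noteq> 0"
    using lead_exp_decomposition[OF assms(2)] unfolding LT_def by metis
  have "Poly_Mapping.keys (LT f) \<noteq> {}" using assms(3) g0 by (simp add: LT_def)
  then have "Poly_Mapping.keys (LT f) = {lead_exp f}" by (simp add: LT_def split: if_splits)
  with assms(3) g0 show e: "lead_exp g = lead_exp f" by (simp add: LT_def)
  have "f - g = (LT f + r) - (LT g + s)" using r(1) s(1) by simp
  then have "f - g = r + - s" using assms(3) by simp
  then show "keys_below (lead_exp f) (f - g)"
    using r(2) s(2) e by (metis keys_below_add keys_below_uminus)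
qed

lemma lead_exp_in_keys:
  fixes f :: "(xyz, 'a::field) mpoly"
  assumes "f \<noteq> 0"
  shows "lead_exp f \<in> Poly_Mapping.keys f"
  using lead_exp_decomposition[OF assms] by (metis in_keys_iff)

lemma Const_mult_nonzero_monic: "c \<noteq> 0 \<Longrightarrow> monic g \<Longrightarrow>
    Const c * g \<noteq> 0 \<and> LT (Const c * g) = Poly_Mapping.single (lead_exp g) c"
proof -
  assume c: "c \<noteq> 0" and g: "monic g"
  have "lead_exp (Const c :: (xyz, 'a) mpoly) = 0" "Poly_Mapping.lookup (Const c :: (xyz, 'a) mpoly) 0 = c"
    using lead_exp_eqI[of "Const c :: (xyz, 'a) mpoly" 0 c 0] c by (auto simp: Const_def keys_below_def)
  then show ?thesis
    using c g lead_exp_mult[of "Const c" g] monic_nonzero[OF g] by (simp add: LT_def monic_def)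
qed

text \<open>Each cancellation stays in the algebra, whose lead monomials are all reached by products of the
  \<open>b i\<close>, and it lowers the lead exponent along a well-founded order.\<close>
lemma subducts_to_zero_exists:
  fixes b :: "'i \<Rightarrow> (xyz, 'a::field) mpoly"
  assumes A: "subalgebra A" and bA: "\<And>i. b i \<in> A" and b: "\<And>I. monic (power_product b I)"
    and gen: "lead_exps_generated b A"
    and f: "f \<in> A"
  shows "\<exists>Q. subducts_to_zero b f Q"
proof -
  have "\<forall>f\<in>A. f \<noteq> 0 \<longrightarrow> lead_exp f = e \<longrightarrow> (\<exists>Q. subducts_to_zero b f Q)" for e
  proof (induction e rule: wf_induct_rule[OF wf_grevlex_less])
    case (1 e)
    show ?case
    proof (intro ballI impI)
      fix f assume f: "f \<in> A" "f \<noteq> 0" "lead_exp f = e"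
      then obtain I where I: "lead_exp f = lead_exp (power_product b I)"
        using gen by (auto simp: lead_exps_generated_def)
      define c where "c = Poly_Mapping.lookup f (lead_exp f)"
      let ?g = "Const c * power_product b I"
      have c: "c \<noteq> 0" using lead_exp_in_keys[OF f(2)] by (simp add: c_def in_keys_iff)
      then have g: "?g \<noteq> 0" "LT f = LT ?g"
        using Const_mult_nonzero_monic[OF c b[of I]] I by (simp_all add: LT_def c_def)
      have below: "keys_below (lead_exp f) (f - ?g)"
        using lead_term_cancel(2)[OF f(2) g] .
      have fgA: "f - ?g \<in> A"
        by (intro subalgebra_minus A f subalgebra_mult subalgebra_Const subalgebra_power_product bA)
      have "\<exists>Q. subducts_to_zero b (f - ?g) Q"
      proof (cases "f - ?g = 0")
        case True
        then show ?thesis using subducts_to_zero.zero by metis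
      next
        case False
        then have "grevlex_less (lead_exp (f - ?g)) e"
          using below lead_exp_in_keys[OF False] f(3) by (auto simp: keys_below_def)
        with 1 fgA False show ?thesis by blast
      qed
      then show "\<exists>Q. subducts_to_zero b f Q"
        using subducts_to_zero.cancel[OF f(2) g(2)] by blast
    qed
  qed
  then show ?thesis using f subducts_to_zero.zero by (cases "f = 0") blast+
qed

lemma subducts_to_zero_subst: "subducts_to_zero b f Q \<Longrightarrow> subst b Q = f"
  by (induction rule: subducts_to_zero.induct) (simp_all add: subst.zero subst.add subst_single)

text \<open>This is what makes the relation of a subduction monic: each product used has the lead monomial of
  the polynomial then at hand, and these lead monomials decrease.\<close>
lemma subducts_to_zero_keys:
  fixes b :: "'i \<Rightarrow> (xyz, 'a::field) mpoly"
  assumes b: "\<And>I. monic (power_product b I)"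
    and "subducts_to_zero b f Q" "keys_below e f" "I \<in> Poly_Mapping.keys Q"
  shows "grevlex_less (lead_exp (power_product b I)) e"
  using assms(2-)
proof (induction rule: subducts_to_zero.induct)
  case (cancel f c J Q)
  let ?g = "Const c * power_product b J"
  have f: "grevlex_less (lead_exp f) e"
    using cancel.prems(1) lead_exp_in_keys[OF cancel.hyps(1)] by (auto simp: keys_below_def)
  have "c \<noteq> 0"
  proof
    assume "c = 0"
    with cancel.hyps(2) have "LT f = 0" by (simp add: LT_def)
    with lead_exp_in_keys[OF cancel.hyps(1)] show False
      unfolding LT_def by (metis in_keys_iff lookup_single_eq lookup_zero)
  qed
  note g = Const_mult_nonzero_monic[OF this b[of J]]
  have "Poly_Mapping.single (lead_exp f) (Poly_Mapping.lookup f (lead_exp f)) =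
      Poly_Mapping.single (lead_exp (power_product b J)) c"
    using cancel.hyps(2) g by (simp add: LT_def)
  from arg_cong[OF this, of Poly_Mapping.keys]
  have e: "lead_exp (power_product b J) = lead_exp f"
    using \<open>c \<noteq> 0\<close> by (auto split: if_splits)
  have "keys_below e (f - ?g)"
    using lead_term_cancel(2)[OF cancel.hyps(1) _ cancel.hyps(2)] g f keys_below_trans by blast
  with cancel.IH Poly_Mapping.keys_add[of "Poly_Mapping.single J c" Q] cancel.prems(2) f e
  show ?case by (auto split: if_splits)
qed simp

section \<open>The translation action\<close>

lemma CHAR_mpoly: "CHAR(('v, 'a::comm_ring_1) mpoly) = CHAR('a)"
proof (rule CHAR_eqI)
  have of_nat: "(of_nat n :: ('v, 'a) mpoly) = Const (of_nat n)" for n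
    by (induction n) (simp_all add: Const.add)
  show "of_nat CHAR('a) = (0 :: ('v, 'a) mpoly)" by (simp add: of_nat)
  show "CHAR('a) dvd n" if "of_nat n = (0 :: ('v, 'a) mpoly)" for n
    using that by (simp add: of_nat of_nat_eq_0_iff_char_dvd)
qed

lemma power_char_add:
  fixes x y :: "'s::comm_ring_1"
  assumes "prime p" "CHAR('s) = p"
  shows "(x + y) ^ (p ^ n) = x ^ (p ^ n) + y ^ (p ^ n)"
  by (rule freshmans_dream'[where n = n]) (use assms in auto)

lemma power_char_diff:
  fixes x y :: "'s::comm_ring_1"
  assumes "prime p" "CHAR('s) = p"
  shows "(x - y) ^ (p ^ n) = x ^ (p ^ n) - y ^ (p ^ n)"
  using power_char_add[OF assms, of "x - y" y n] by simp

lemma Const_numeral [simp]: "Const (numeral n) = (numeral n :: ('v, 'a::comm_ring_1) mpoly)"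
  by (simp add: Const_def)

definition translation :: "'a::field \<Rightarrow> 'a \<Rightarrow> (xyz, 'a) mpoly \<Rightarrow> (xyz, 'a) mpoly" where
  "translation a b = subst (\<lambda>v. case v of
       X \<Rightarrow> Var X
     | Y \<Rightarrow> Var Y + Const a * Var X
     | Z \<Rightarrow> Var Z + Const (2 * a) * Var Y + Const (a\<^sup>2 + b) * Var X)"

interpretation translation: ring_morphism "translation a b"
  unfolding translation_def ..

lemma translation_simps [simp]:
  "translation a b (Const c) = Const c"
  "translation a b (numeral n) = numeral n"
  "translation a b (Var X) = Var X"
  "translation a b (Var Y) = Var Y + Const a * Var X"
  "translation a b (Var Z) = Var Z + Const (2 * a) * Var Y + Const (a\<^sup>2 + b) * Var X"
  using subst_Const[of _ "numeral n :: 'a"] by (simp_all add: translation_def)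

lemma translation_translation:
  "translation a b (translation a' b' f) = translation (a + a') (b + b') f"
proof (rule ring_morphism_eqI[where ?h1.0 = "\<lambda>f. translation a b (translation a' b' f)"])
  show "ring_morphism (\<lambda>f. translation a b (translation a' b' f))"
    by unfold_locales (simp_all add: translation.add translation.mult translation.one)
  show "ring_morphism (translation (a + a') (b + b'))" ..
  show "translation a b (translation a' b' (Var v)) = translation (a + a') (b + b') (Var v)" for v
    by (cases v) (simp_all add: translation.add translation.mult Const.add Const.mult
      mult_2 power2_eq_square algebra_simps)
qed simp

lemma translation_0: "translation 0 0 f = (f :: (xyz, 'a::field) mpoly)"
proof (rule ring_morphism_eqI[where ?h1.0 = "translation 0 0" and ?h2.0 = "\<lambda>f. f"])
  show "translation 0 0 (Var v) = (Var v :: (xyz, 'a) mpoly)" for v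
    by (cases v) simp_all
  show "ring_morphism (translation 0 (0::'a))" ..
  show "ring_morphism (\<lambda>f :: (xyz, 'a) mpoly. f)" by unfold_locales simp_all
qed simp

lemma translation_delta: "translation a b delta = delta - Const b * (Var X)\<^sup>2"
  by (simp add: delta_def translation.add translation.mult translation.diff translation.power
      Const.add Const.mult mult_2 power2_eq_square algebra_simps)

definition degree_le :: "nat \<Rightarrow> (xyz, 'a::zero) mpoly \<Rightarrow> bool" where
  "degree_le n f \<longleftrightarrow> (\<forall>m\<in>Poly_Mapping.keys f. total_degree m \<le> n)"

lemma degree_le_add: "degree_le n f \<Longrightarrow> degree_le n g \<Longrightarrow> degree_le n (f + g)"
  using Poly_Mapping.keys_add[of f g] by (auto simp: degree_le_def)

lemma degree_le_uminus: "degree_le n (f :: (xyz, 'a::ab_group_add) mpoly) \<Longrightarrow> degree_le n (- f)"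
  by (auto simp: degree_le_def in_keys_iff)

lemma degree_le_diff: "degree_le n f \<Longrightarrow> degree_le n g \<Longrightarrow> degree_le n (f - g :: (xyz, 'a::ab_group_add) mpoly)"
  using degree_le_add[of n f "- g"] degree_le_uminus[of n g] by simp

lemma degree_le_mult:
  assumes "degree_le i f" "degree_le j g"
  shows "degree_le (i + j) (f * g)"
  using assms keys_mult[of f g] by (force simp: degree_le_def total_degree_add intro: add_mono)

lemma degree_le_power: "degree_le i f \<Longrightarrow> degree_le (n * i) (f ^ n :: (xyz, 'a::comm_ring_1) mpoly)"
proof (induction n)
  case 0 show ?case by (simp add: degree_le_def total_degree_xyz)
next
  case (Suc n) then show ?case using degree_le_mult[of i f "n * i" "f ^ n"] by simp
qed

lemma degree_le_Var: "degree_le 1 (Var v :: (xyz, 'a::comm_ring_1) mpoly)"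
  by (cases v) (auto simp: degree_le_def Var_def total_degree_xyz lookup_single)

lemma degree_le_Const_mult: "degree_le n f \<Longrightarrow> degree_le n (Const c * f :: (xyz, 'a::comm_ring_1) mpoly)"
  using degree_le_mult[of 0 "Const c" n f] by (auto simp: degree_le_def Const_def total_degree_xyz)

lemma Var_power: "Var v ^ n = (Poly_Mapping.single (Poly_Mapping.single v n) 1 :: ('v, 'a::comm_ring_1) mpoly)"
  using single_eq_power_product[of "Poly_Mapping.single v n" "1::'a"] by simp

text \<open>With \<open>x\<close> the smallest variable, a monomial containing \<open>x\<close> lies below every monomial of at least the
  same degree that is prime to \<open>x\<close>.\<close>
lemma keys_below_mult_X_power:
  fixes r :: "(xyz, 'a::comm_ring_1) mpoly"
  assumes "degree_le d r" "d + j \<le> n" "0 < j"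
  shows "keys_below (Poly_Mapping.single Y n) (r * Var X ^ j)"
  unfolding keys_below_def
proof
  fix m assume "m \<in> Poly_Mapping.keys (r * Var X ^ j)"
  with keys_mult[of r "Var X ^ j"] obtain a where
    m: "m = a + Poly_Mapping.single X j" "a \<in> Poly_Mapping.keys r"
    by (auto simp: Var_power)
  with assms have "total_degree a \<le> d" by (auto simp: degree_le_def)
  with m assms show "grevlex_less m (Poly_Mapping.single Y n)"
    by (auto simp: grevlex_less_iff total_degree_xyz lookup_add lookup_single)
qed

lemma monic_Var: "monic (Var v :: (xyz, 'a::field) mpoly)"
  and lead_exp_Var: "lead_exp (Var v :: (xyz, 'a::field) mpoly) = Poly_Mapping.single v 1"
  using lead_exp_eqI[of "Var v :: (xyz, 'a) mpoly" "Poly_Mapping.single v 1" 1 0]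
  by (auto simp: Var_def monic_def keys_below_def)

lemma monicI:
  assumes "f = Var v ^ n + r" "keys_below (Poly_Mapping.single v n) r"
  shows "monic f" "lead_exp f = Poly_Mapping.single v n"
  using lead_exp_eqI[of f "Poly_Mapping.single v n" 1 r] assms
  by (simp_all add: monic_def Var_power)

lemma fract_morphism: "ring_morphism (\<lambda>r::'r::idom. Fract r 1)"
  by unfold_locales (simp_all add: One_fract_def)

section \<open>The generators\<close>

text \<open>The data that remain of the matrix: \<open>A\<close> consists of the combinations of the entries of the first
  row with coefficients in the prime field, \<open>c1\<close> and \<open>c2\<close> express the second row through the
  first one and its \<open>p\<^sup>2\<close>-th powers, and \<open>n0\<close>, ..., \<open>n3\<close> are the coefficients of the
  additive polynomial with set of roots \<open>A\<close>.\<close>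
locale translation_group =
  fixes p :: nat and A :: "'a::field set" and c1 c2 n0 n1 n2 n3 :: 'a
  assumes p: "prime p" "p > 2" and char: "CHAR('a) = p"
    and A: "finite A" "card A = p ^ 4" "0 \<in> A" "\<And>a b. a \<in> A \<Longrightarrow> b \<in> A \<Longrightarrow> a + b \<in> A"
    and c2: "c2 \<noteq> 0"
    and root: "\<And>a. a \<in> A \<Longrightarrow> a ^ p ^ 4 = n3 * a ^ p ^ 3 + n2 * a ^ p ^ 2 + n1 * a ^ p + n0 * a"
begin

definition q :: nat where "q = p ^ 2"

text \<open>The translation of \<open>\<delta> / x\<^sup>2\<close> (up to sign) that accompanies the translation of \<open>y / x\<close> by \<open>a\<close>.\<close>
definition beta :: "'a \<Rightarrow> 'a" where "beta a = (a ^ q - c1 * a) / c2"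

definition act :: "'a \<Rightarrow> (xyz, 'a) mpoly \<Rightarrow> (xyz, 'a) mpoly" where
  "act a = translation a (beta a)"

definition Inv :: "(xyz, 'a) mpoly set" where
  "Inv = {f. \<forall>a\<in>A. act a f = f}"

text \<open>The quadric for which \<open>y\<^sup>q + eps x\<^sup>q\<^sup>-\<^sup>2\<close> is invariant: it is lowered by \<open>a\<^sup>q x\<^sup>2\<close> under the translation by \<open>a\<close>.\<close>
definition eps :: "(xyz, 'a) mpoly" where
  "eps = Const c2 * delta - Const c1 * Var Y * Var X"

definition f1 :: "(xyz, 'a) mpoly" where
  "f1 = Var Y ^ q + eps * Var X ^ (q - 2)"

definition Ny :: "(xyz, 'a) mpoly" where
  "Ny = (\<Prod>a\<in>A. Var Y + Const a * Var X)"

definition Nz :: "(xyz, 'a) mpoly" where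
  "Nz = (\<Prod>a\<in>A. act a (Var Z))"

text \<open>The result of dividing the combination of \<open>N(y)\<close> and powers of \<open>f1\<close> that defines the third
  generator by the largest power of \<open>x\<close> in it.\<close>
definition h2_num :: "(xyz, 'a) mpoly" where
  "h2_num = Const (2 * c2 ^ q) * Var Y ^ q * eps + Const (c2 ^ q) * eps\<^sup>2 * Var X ^ (q - 2)
     + Const (c2 ^ q) * Var Z ^ q * (Var X)\<^sup>2 + Const (c1 ^ q - n2) * Var Y ^ q * (Var X)\<^sup>2
     + Const n3 * eps ^ p * Var X ^ (q + 2 - 2 * p) - Const n1 * Var Y ^ p * Var X ^ (q + 2 - p)
     - Const n0 * Var Y * Var X ^ (q + 1)"

definition h2 :: "(xyz, 'a) mpoly" where
  "h2 = Const (1 / (2 * c2 ^ (q + 1))) * h2_num"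

lemma exponent_bounds: "3 \<le> p" "3 * p \<le> q" "9 \<le> q" "3 * (p * q) \<le> q * q" "3 * q \<le> p * q"
  "p ^ 2 = q" "p ^ 3 = p * q" "p ^ 4 = q * q"
proof -
  show p3: "3 \<le> p" using p by simp
  then show pq: "3 * p \<le> q" by (simp add: q_def power2_eq_square)
  with p3 show "9 \<le> q" by simp
  show "3 * (p * q) \<le> q * q" using pq by (metis mult.assoc mult_le_mono1)
  show "3 * q \<le> p * q" using p3 by simp
qed (simp_all add: q_def power2_eq_square power3_eq_cube power4_eq_xxxx)

lemma two_nonzero: "(2::'a) \<noteq> 0"
proof
  assume "(2::'a) = 0"
  then have "of_nat 2 = (0::'a)" by simp
  then have "p dvd 2" unfolding of_nat_eq_0_iff_char_dvd char .
  with p show False by (auto dest: dvd_imp_le)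
qed

lemma frobenius_q:
  fixes f g :: "(xyz, 'a) mpoly"
  shows "(f + g) ^ q = f ^ q + g ^ q" "(f - g) ^ q = f ^ q - g ^ q" "(f + g) ^ p = f ^ p + g ^ p"
  using power_char_add[OF p(1), where 's = "(xyz, 'a) mpoly", of f g 2]
    power_char_diff[OF p(1), where 's = "(xyz, 'a) mpoly", of f g 2]
    power_char_add[OF p(1), where 's = "(xyz, 'a) mpoly", of f g 1]
  by (simp_all add: CHAR_mpoly char q_def)

lemma beta_add: "beta (a + b) = beta a + beta b"
  using power_char_add[OF p(1) char, of a b 2]
  by (simp add: beta_def q_def algebra_simps flip: add_divide_distrib)

lemma beta_0 [simp]: "beta 0 = 0"
  using exponent_bounds by (simp add: beta_def zero_power)

lemma beta_eq: "c2 * beta a = a ^ q - c1 * a"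
  using c2 by (simp add: beta_def)

lemma act_act: "act a (act b f) = act (a + b) f"
  by (simp add: act_def translation_translation beta_add)

sublocale act: ring_morphism "act a" for a
  unfolding act_def ..

lemma act_simps [simp]: "act a (Const c) = Const c" "act a (Var X) = Var X"
  "act a (Var Y) = Var Y + Const a * Var X"
  by (simp_all add: act_def)

lemma translate_A: "a \<in> A \<Longrightarrow> (\<lambda>b. a + b) ` A = A"
  by (rule endo_inj_surj) (use A in auto)

lemma subalgebra_Inv: "subalgebra Inv"
  by (auto simp: subalgebra_def Inv_def act.add act.mult)

lemma X_Inv: "Var X \<in> Inv" by (simp add: Inv_def)

lemma act_eps: "act a eps = eps - Const (a ^ q) * (Var X)\<^sup>2"
proof -
  have "Const (a ^ q) = Const c2 * Const (beta a) + Const c1 * (Const a :: (xyz, 'a) mpoly)"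
    using beta_eq[of a] by (simp flip: Const.mult Const.add)
  then show ?thesis
    by (simp add: eps_def act_def translation.diff translation.mult translation_delta
      power2_eq_square algebra_simps)
qed

lemma f1_Inv: "f1 \<in> Inv"
proof -
  have "q = q - 2 + 2" using exponent_bounds by simp
  then have Xq: "Var X ^ q = Var X ^ (q - 2) * (Var X :: (xyz, 'a) mpoly)\<^sup>2" by (metis power_add)
  have "act a f1 = f1" for a
    unfolding f1_def act.add act.mult act.power act_eps act_simps frobenius_q power_mult_distrib Xq
    by (simp add: algebra_simps flip: Const.power)
  then show ?thesis by (simp add: Inv_def)
qed

lemma Ny_Inv: "Ny \<in> Inv"
proof -
  have "act a Ny = Ny" if "a \<in> A" for a
  proof -
    have "act a Ny = (\<Prod>b\<in>A. Var Y + Const (a + b) * Var X)"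
      by (simp add: Ny_def act.prod act.add act.mult Const.add algebra_simps)
    also have "\<dots> = (\<Prod>b\<in>(\<lambda>b. a + b) ` A. Var Y + Const b * Var X)"
      by (subst prod.reindex) simp_all
    finally show ?thesis by (simp add: translate_A[OF that] Ny_def)
  qed
  then show ?thesis by (simp add: Inv_def)
qed

lemma Nz_Inv: "Nz \<in> Inv"
proof -
  have "act a Nz = Nz" if "a \<in> A" for a
  proof -
    have "act a Nz = (\<Prod>b\<in>(\<lambda>b. a + b) ` A. act b (Var Z))"
      by (subst prod.reindex) (simp_all add: Nz_def act.prod act_act)
    then show ?thesis by (simp add: translate_A[OF that] Nz_def)
  qed
  then show ?thesis by (simp add: Inv_def)
qed

lemma Ny_minus: "Ny = (\<Prod>a\<in>A. Var Y - Const a * Var X)"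
proof -
  have "uminus ` A \<subseteq> A" using finite_additive_uminus[of A] A by blast
  moreover from this have "A \<subseteq> uminus ` A" by force
  ultimately have "uminus ` A = A" by blast
  then have "Ny = (\<Prod>a\<in>uminus ` A. Var Y + Const a * Var X)" by (simp add: Ny_def)
  also have "\<dots> = (\<Prod>a\<in>A. Var Y - Const a * Var X)"
    by (subst prod.reindex) (simp_all add: Const.uminus)
  finally show ?thesis .
qed

text \<open>The set \<open>A\<close> consists of \<open>p\<^sup>4\<close> roots of the additive polynomial of degree \<open>p\<^sup>4\<close>, which is therefore
  the product of its linear factors.\<close>
lemma Ny_expansion:
  "Ny = Var Y ^ (q * q) - Const n3 * Var X ^ (q * q - p * q) * Var Y ^ (p * q)
     - Const n2 * Var X ^ (q * q - q) * Var Y ^ q - Const n1 * Var X ^ (q * q - p) * Var Y ^ p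
     - Const n0 * Var X ^ (q * q - 1) * Var Y"
proof -
  \<comment> \<open>Homogenizing by evaluating over the polynomial ring itself: the multiples \<open>a x\<close> are the roots
    of the homogenized additive polynomial, whose value at \<open>y\<close> is wanted.\<close>
  define V where "V = (\<lambda>a. Const a * Var X :: (xyz, 'a) mpoly) ` A"
  have X0: "Var X \<noteq> (0 :: (xyz, 'a) mpoly)" using monic_nonzero[OF monic_Var] .
  have inj: "inj_on (\<lambda>a. Const a * Var X :: (xyz, 'a) mpoly) A"
  proof (rule inj_onI)
    fix a b assume "Const a * Var X = Const b * (Var X :: (xyz, 'a) mpoly)"
    with X0 have "Const (a - b) = (0 :: (xyz, 'a) mpoly)" by (simp add: Const.diff)
    then show "a = b" by simp
  qed
  then have V: "finite V" "card V = q * q"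
    using A exponent_bounds by (simp_all add: V_def card_image)
  define R :: "(xyz, 'a) mpoly poly" where
    "R = monom (Const n3 * Var X ^ (q * q - p * q)) (p * q) + monom (Const n2 * Var X ^ (q * q - q)) q
      + monom (Const n1 * Var X ^ (q * q - p)) p + monom (Const n0 * Var X ^ (q * q - 1)) 1"
  have R: "degree R < q * q"
    unfolding R_def using exponent_bounds
    by (intro degree_add_less le_less_trans[OF degree_monom_le]) linarith+
  let ?P = "monom 1 (q * q) - R"
  have deg: "degree ?P = q * q" "lead_coeff ?P = 1"
  proof -
    have "degree (- R) < degree (monom (1 :: (xyz, 'a) mpoly) (q * q))" using R by (simp add: degree_monom_eq)
    from degree_add_eq_left[OF this] show 1: "degree ?P = q * q" by (simp add: degree_monom_eq)
    show "lead_coeff ?P = 1" unfolding 1 using R by (simp add: coeff_eq_0)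
  qed
  have "poly ?P v = 0" if v: "v \<in> V" for v
  proof -
    obtain a where a: "a \<in> A" "v = Const a * Var X" using v by (auto simp: V_def)
    have Xp: "Var X ^ (q * q - j) * Var X ^ j = (Var X ^ (q * q) :: (xyz, 'a) mpoly)" if "j \<le> q * q" for j
      using that by (simp flip: power_add)
    have le: "p * q \<le> q * q" "q \<le> q * q" "p \<le> q * q" "1 \<le> q * q"
      using exponent_bounds by linarith+
    have "poly R v = Const (n3 * a ^ (p * q) + n2 * a ^ q + n1 * a ^ p + n0 * a) * Var X ^ (q * q)"
      using Xp[OF le(1)] Xp[OF le(2)] Xp[OF le(3)] Xp[OF le(4)] unfolding R_def a
      by (simp add: poly_monom power_mult_distrib Const.add Const.mult Const.power algebra_simps)
    also have "n3 * a ^ (p * q) + n2 * a ^ q + n1 * a ^ p + n0 * a = a ^ (q * q)"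
      using root[OF a(1)] exponent_bounds by simp
    finally show ?thesis
      by (simp add: poly_monom a power_mult_distrib Const.power)
  qed
  from monic_eq_prod_linear_factors[OF V(1) this] deg V
  have "?P = (\<Prod>v\<in>V. [:- v, 1:])" by simp
  also have "\<dots> = (\<Prod>a\<in>A. [:- (Const a * Var X), 1:])"
    unfolding V_def by (subst prod.reindex[OF inj]) simp
  finally have "poly ?P (Var Y) = (\<Prod>a\<in>A. Var Y - Const a * Var X)"
    by (simp add: poly_prod)
  then show ?thesis by (simp add: Ny_minus R_def poly_monom algebra_simps)
qed

text \<open>The powers \<open>y ^ (q * q)\<close> and \<open>y ^ (p * q)\<close> cancel against \<open>f1\<^sup>q\<close> and \<open>f1\<^sup>p\<close>, and the square \<open>f1\<^sup>2\<close>
  accounts for the term \<open>y ^ (2 * q)\<close> of the \<open>q\<close>-th power of \<open>\<delta>\<close>; its mixed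
  term \<open>2 y\<^sup>q eps\<close> is what remains at the lowest power of \<open>x\<close>.\<close>
lemma Ny_h2_num:
  "Ny = f1 ^ q - Const n3 * f1 ^ p * Var X ^ (q * q - p * q) - Const (c2 ^ q) * f1\<^sup>2 * Var X ^ (q * q - 2 * q)
     + h2_num * Var X ^ (q * q - q - 2)"
proof -
  let ?x = "Var X :: (xyz, 'a) mpoly" and ?y = "Var Y :: (xyz, 'a) mpoly" and ?z = "Var Z :: (xyz, 'a) mpoly"
  \<comment> \<open>Once the large powers of \<open>x\<close> are written through these two, the claim is a polynomial identity.\<close>
  define T where "T = ?x ^ (q * q - 2 * q)"
  define K where "K = ?x ^ (q - 2)"
  note b = exponent_bounds
  have d: "(q - 2) * q = q * q - 2 * q" "(q - 2) * p = p * q - 2 * p"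
    by (simp_all only: diff_mult_distrib mult.commute[of q p])
  have es: "q * q - q - 2 = q * q - 2 * q + (q - 2)" "q * q - q = q * q - 2 * q + (q - 2) + 2"
    "q * q - p = q * q - 2 * q + (q - 2) + (q + 2 - p)" "q * q - 1 = q * q - 2 * q + (q - 2) + (q + 1)"
    "(q - 2) * q = q * q - 2 * q" "q - 2 + 2 = q"
    "(q - 2) * p + (q * q - p * q) = q * q - 2 * q + (q - 2) + (q + 2 - 2 * p)"
    using b d by linarith+
  have xs: "?x ^ (q * q - q - 2) = T * K" "?x ^ (q * q - q) = T * K * ?x\<^sup>2"
    "?x ^ (q * q - p) = T * K * ?x ^ (q + 2 - p)" "?x ^ (q * q - 1) = T * K * ?x ^ (q + 1)"
    "K ^ q = T" "?x ^ q = K * ?x\<^sup>2"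
    "K ^ p * ?x ^ (q * q - p * q) = T * K * ?x ^ (q + 2 - 2 * p)"
    unfolding T_def K_def power_mult[symmetric] power_add[symmetric]
    by (simp_all only: es add_diff_cancel_right')
  have eq: "eps ^ q = Const (c2 ^ q) * (?y ^ q * ?y ^ q - ?x ^ q * ?z ^ q) - Const (c1 ^ q) * ?y ^ q * ?x ^ q"
    unfolding eps_def delta_def frobenius_q power_mult_distrib
    by (simp add: Const.power power2_eq_square power_mult_distrib)
  have f1q: "f1 ^ q = ?y ^ (q * q) + eps ^ q * T"
    unfolding f1_def frobenius_q power_mult_distrib K_def[symmetric] xs by (simp add: power_mult)
  have f1p: "f1 ^ p * ?x ^ (q * q - p * q) =
      ?y ^ (p * q) * ?x ^ (q * q - p * q) + eps ^ p * (T * K * ?x ^ (q + 2 - 2 * p))"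
    unfolding f1_def frobenius_q power_mult_distrib K_def[symmetric]
    by (simp only: distrib_right mult.assoc xs(7) power_mult[symmetric] mult.commute[of q p])
  have f12: "f1\<^sup>2 = ?y ^ q * ?y ^ q + 2 * ?y ^ q * eps * K + eps\<^sup>2 * K\<^sup>2"
    unfolding f1_def K_def by (simp add: power2_eq_square algebra_simps)
  have two: "Const (2 * c2 ^ q) = 2 * (Const (c2 ^ q) :: (xyz, 'a) mpoly)"
    unfolding mult_2 Const.add ..
  show ?thesis
    unfolding Ny_expansion h2_num_def mult.assoc[of "Const n3" "f1 ^ p"] f1p f1q f12 eq xs two
      K_def[symmetric] T_def[symmetric]
    by (simp add: Const.diff power2_eq_square algebra_simps)
qed

lemma h2_num_eq: "h2_num = Const (2 * c2 ^ (q + 1)) * h2"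
proof -
  have "2 * c2 ^ (q + 1) * (1 / (2 * c2 ^ (q + 1))) = 1"
    using c2 two_nonzero by simp
  then have "Const (2 * c2 ^ (q + 1)) * Const (1 / (2 * c2 ^ (q + 1))) = (1 :: (xyz, 'a) mpoly)"
    unfolding Const.mult[symmetric] by simp
  then show ?thesis unfolding h2_def mult.assoc[symmetric] by simp
qed

text \<open>A power of \<open>x\<close> times \<open>h2\<close> is a polynomial in invariants, and that power is cancellable.\<close>
lemma h2_Inv: "h2 \<in> Inv"
proof -
  let ?x = "Var X :: (xyz, 'a) mpoly"
  let ?e = "q * q - q - 2"
  have "h2_num * ?x ^ ?e = Ny - f1 ^ q + Const n3 * f1 ^ p * Var X ^ (q * q - p * q)
      + Const (c2 ^ q) * f1\<^sup>2 * Var X ^ (q * q - 2 * q)"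
    unfolding Ny_h2_num by simp
  also have "\<dots> \<in> Inv"
    by (intro subalgebra_add subalgebra_minus subalgebra_mult subalgebra_power subalgebra_Const
        subalgebra_Inv Ny_Inv f1_Inv X_Inv)
  finally have "act a h2_num * ?x ^ ?e = h2_num * ?x ^ ?e" if "a \<in> A" for a
    using that by (auto simp: Inv_def act.mult act.power)
  moreover have "?x \<noteq> 0" by (rule monic_nonzero[OF monic_Var])
  ultimately have "h2_num \<in> Inv" by (simp add: Inv_def)
  then show ?thesis
    unfolding h2_def by (intro subalgebra_mult subalgebra_Const subalgebra_Inv)
qed

lemma degree_le_eps: "degree_le 2 eps"
proof -
  have 2: "degree_le 2 (Var u * Var v :: (xyz, 'a) mpoly)" for u v
    using degree_le_mult[OF degree_le_Var degree_le_Var, of u v] unfolding one_add_one .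
  show ?thesis
    unfolding eps_def delta_def power2_eq_square mult.assoc
    by (intro degree_le_diff degree_le_Const_mult 2)
qed

lemma monic_f1: "monic f1" and lead_exp_f1: "lead_exp f1 = Poly_Mapping.single Y q"
proof -
  have "keys_below (Poly_Mapping.single Y q) (eps * Var X ^ (q - 2))"
    by (rule keys_below_mult_X_power[OF degree_le_eps]) (use exponent_bounds in auto)
  from monicI[OF f1_def this] show "monic f1" "lead_exp f1 = Poly_Mapping.single Y q" .
qed

text \<open>Modulo \<open>x\<close> only the term \<open>y\<^sup>q eps\<close> survives, and \<open>eps\<close> is congruent to \<open>c2 y\<^sup>2\<close>.\<close>
lemma monic_h2: "monic h2" and lead_exp_h2: "lead_exp h2 = Poly_Mapping.single Y (q + 2)"
proof -
  let ?x = "Var X :: (xyz, 'a) mpoly" and ?y = "Var Y :: (xyz, 'a) mpoly" and ?z = "Var Z :: (xyz, 'a) mpoly"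
  let ?c = "Const (1 / (2 * c2 ^ (q + 1))) :: (xyz, 'a) mpoly"
  \<comment> \<open>Every summand of \<open>r\<close> has degree at most \<open>q + 2\<close> and contains \<open>x\<close>.\<close>
  define r where "r = Const (2 * c2 ^ q) * (?y ^ q * (- (Const c2 * ?z) - Const c1 * ?y)) * ?x ^ 1
     + Const (c2 ^ q) * eps\<^sup>2 * ?x ^ (q - 2)
     + Const (c2 ^ q) * ?z ^ q * ?x\<^sup>2 + Const (c1 ^ q - n2) * ?y ^ q * ?x\<^sup>2
     + Const n3 * eps ^ p * ?x ^ (q + 2 - 2 * p) + - (Const n1 * ?y ^ p * ?x ^ (q + 2 - p))
     + - (Const n0 * ?y * ?x ^ (q + 1))"
  have "h2_num = Const (2 * c2 ^ (q + 1)) * ?y ^ (q + 2) + r"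
    unfolding h2_num_def r_def
    by (simp add: eps_def[of] delta_def Const.mult power_add power2_eq_square algebra_simps)
  moreover have "?c * Const (2 * c2 ^ (q + 1)) = 1"
    unfolding Const.mult[symmetric] using c2 two_nonzero by simp
  ultimately have h2: "h2 = ?y ^ (q + 2) + ?c * r"
    unfolding h2_def by (simp add: distrib_left flip: mult.assoc)
  note b = exponent_bounds
  have "keys_below (Poly_Mapping.single Y (q + 2)) r"
    unfolding r_def
  proof (intro keys_below_add keys_below_uminus)
    have y: "degree_le n (?y ^ n)" and z: "degree_le n (?z ^ n)" for n
      using degree_le_power[OF degree_le_Var, of n] by simp_all
    have "degree_le 1 (- (Const c2 * ?z) - Const c1 * ?y)"
      by (intro degree_le_diff degree_le_uminus degree_le_Const_mult degree_le_Var)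
    from degree_le_Const_mult[OF degree_le_mult[OF y[of q] this]]
    show "keys_below (Poly_Mapping.single Y (q + 2))
      (Const (2 * c2 ^ q) * (?y ^ q * (- (Const c2 * ?z) - Const c1 * ?y)) * ?x ^ 1)"
      by (rule keys_below_mult_X_power) auto
    show "keys_below (Poly_Mapping.single Y (q + 2)) (Const (c2 ^ q) * eps\<^sup>2 * ?x ^ (q - 2))"
      by (rule keys_below_mult_X_power[OF degree_le_Const_mult[OF degree_le_power[OF degree_le_eps]]])
         (use b in auto)
    show "keys_below (Poly_Mapping.single Y (q + 2)) (Const (c2 ^ q) * ?z ^ q * ?x\<^sup>2)"
      by (rule keys_below_mult_X_power[OF degree_le_Const_mult[OF z]]) auto
    show "keys_below (Poly_Mapping.single Y (q + 2)) (Const (c1 ^ q - n2) * ?y ^ q * ?x\<^sup>2)"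
      by (rule keys_below_mult_X_power[OF degree_le_Const_mult[OF y]]) auto
    show "keys_below (Poly_Mapping.single Y (q + 2)) (Const n3 * eps ^ p * ?x ^ (q + 2 - 2 * p))"
      by (rule keys_below_mult_X_power[OF degree_le_Const_mult[OF degree_le_power[OF degree_le_eps]]])
         (use b in auto)
    show "keys_below (Poly_Mapping.single Y (q + 2)) (Const n1 * ?y ^ p * ?x ^ (q + 2 - p))"
      by (rule keys_below_mult_X_power[OF degree_le_Const_mult[OF y]]) (use b in auto)
    show "keys_below (Poly_Mapping.single Y (q + 2)) (Const n0 * ?y * ?x ^ (q + 1))"
      by (rule keys_below_mult_X_power[OF degree_le_Const_mult[OF degree_le_Var]]) auto
  qed
  then have "keys_below (Poly_Mapping.single Y (q + 2)) (?c * r)"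
    using keys_below_mult_single[of "Poly_Mapping.single Y (q + 2)" r 0 "1 / (2 * c2 ^ (q + 1))"]
    by (simp add: Const_def mult.commute)
  from monicI[OF h2 this] show "monic h2" "lead_exp h2 = Poly_Mapping.single Y (q + 2)" .
qed

lemma monic_Nz: "monic Nz" and lead_exp_Nz: "lead_exp Nz = Poly_Mapping.single Z (q * q)"
proof -
  have Z: "monic (act a (Var Z)) \<and> lead_exp (act a (Var Z)) = Poly_Mapping.single Z 1" for a
  proof -
    have "keys_below (Poly_Mapping.single Z 1)
       (Const (2 * a) * Var Y + Const (a\<^sup>2 + beta a) * (Var X :: (xyz, 'a) mpoly))"
      by (rule keys_below_add)
         (simp_all add: Var_def keys_below_single grevlex_less_iff total_degree_xyz lookup_single)
    from monicI[OF _ this, of "act a (Var Z)"] show ?thesis by (simp add: act_def add.assoc)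
  qed
  with monic_prod[of A "\<lambda>a. act a (Var Z)"]
  have 1: "monic Nz" "expo (lead_exp Nz) v = (\<Sum>a\<in>A. expo (Poly_Mapping.single Z 1) v)" for v
    unfolding Nz_def by auto
  show "monic Nz" by (rule 1)
  show "lead_exp Nz = Poly_Mapping.single Z (q * q)"
    by (rule xyz_exponent_eqI) (use A exponent_bounds in \<open>simp_all add: 1 lookup_single\<close>)
qed

section \<open>Invariants up to powers of x\<close>

text \<open>The ring \<open>F[x, f1]\<close> is represented by polynomials in two independent variables, so that the lemma on
  translations applies to polynomials over it.\<close>
definition iota :: "(bool, 'a) mpoly \<Rightarrow> (xyz, 'a) mpoly" where
  "iota = subst (\<lambda>v. if v then f1 else Var X)"

sublocale iota: ring_morphism iota
  unfolding iota_def ..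

lemma iota_simps [simp]: "iota (Const c) = Const c" "iota (Var False) = Var X" "iota (Var True) = f1"
  by (simp_all add: iota_def)

text \<open>The map from polynomials in \<open>y\<close> over that ring. It is injective, and surjective up to powers of
  \<open>x\<close>, so that invariance can be studied in a polynomial ring in one variable.\<close>
definition phi :: "(bool, 'a) mpoly poly \<Rightarrow> (xyz, 'a) mpoly" where
  "phi = iota.eval_poly (Var Y)"

sublocale phi: ring_morphism phi
  unfolding phi_def by (rule iota.ring_morphism_eval_poly)

lemma phi_monom: "phi (monom a n) = iota a * Var Y ^ n"
  by (simp add: phi_def iota.eval_poly_monom)

lemma phi_pCons: "phi (pCons a g) = iota a + Var Y * phi g"
  by (simp add: phi_def)

lemma X_nonzero: "(Var X :: (xyz, 'a) mpoly) \<noteq> 0"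
  by (rule monic_nonzero[OF monic_Var])

lemma Var_False_nonzero: "(Var False :: (bool, 'a) mpoly) \<noteq> 0"
  using X_nonzero iota_simps(2) iota.zero by metis

lemma X_power_pred: "Var X ^ (q - 1) = Var X * (Var X ^ (q - 2) :: (xyz, 'a) mpoly)"
proof -
  have "q - 1 = Suc (q - 2)" using exponent_bounds by simp
  then show ?thesis by simp
qed

lemma f1_solve_Z:
  "Const c2 * Var X ^ (q - 1) * Var Z =
     Var Y ^ q + Const c2 * Var X ^ (q - 2) * (Var Y)\<^sup>2 - Const c1 * Var X ^ (q - 1) * Var Y - f1"
  unfolding f1_def eps_def delta_def X_power_pred by (simp add: algebra_simps power2_eq_square)

lemma phi_inj: "phi g = 0 \<Longrightarrow> g = 0"
proof -
  \<comment> \<open>A left inverse: over the fraction field the relation defining \<open>f1\<close> can be solved for \<open>z\<close>.\<close>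
  let ?fr = "\<lambda>r :: (bool, 'a) mpoly. Fract r 1"
  interpret fr: ring_morphism ?fr by (rule fract_morphism)
  define k where "k = (\<lambda>c :: 'a. [:?fr (Const c):])"
  interpret k: ring_morphism k
    by unfold_locales (simp_all add: k_def Const.add Const.mult fr.add fr.mult one_pCons One_fract_def
        del: add_fract mult_fract)
  define x where "x = [:?fr (Var False):]"
  define t where "t = [:0 :: (bool, 'a) mpoly fract, 1:]"
  define d where "d = ?fr (Const c2) * ?fr (Var False) ^ (q - 1)"
  define w where "w = t ^ q + k c2 * x ^ (q - 2) * t\<^sup>2 - k c1 * x ^ (q - 1) * t - [:?fr (Var True):]"
  define z where "z = smult (inverse d) w"
  define psi where "psi = mpoly_eval k (\<lambda>v. case v of X \<Rightarrow> x | Y \<Rightarrow> t | Z \<Rightarrow> z)"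
  interpret psi: ring_morphism psi
    unfolding psi_def by (rule k.ring_morphism_mpoly_eval)
  have psi [simp]: "psi (Const c) = k c" "psi (Var X) = x" "psi (Var Y) = t" "psi (Var Z) = z" for c
    by (simp_all add: psi_def k.mpoly_eval_Const k.mpoly_eval_Var)
  have fr0: "?fr r = 0 \<longleftrightarrow> r = 0" for r by (simp add: Zero_fract_def eq_fract)
  have "d \<noteq> 0" using c2 Var_False_nonzero by (simp add: d_def fr0)
  moreover have "[:d:] = k c2 * x ^ (q - 1)"
    by (simp add: d_def k_def x_def poly_const_pow)
  moreover from calculation(1) have "[:d:] * z = w" by (simp add: z_def)
  ultimately have "k c2 * x ^ (q - 1) * z = w" by metis
  moreover have "psi (Const c2 * Var X ^ (q - 1) * Var Z) = k c2 * x ^ (q - 1) * z"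
    by (simp add: psi.mult psi.power)
  ultimately have z: "psi (Const c2 * Var X ^ (q - 1) * Var Z) = w" by simp
  have "f1 = Var Y ^ q + Const c2 * Var X ^ (q - 2) * (Var Y)\<^sup>2 - Const c1 * Var X ^ (q - 1) * Var Y
      - Const c2 * Var X ^ (q - 1) * Var Z"
    unfolding f1_solve_Z by simp
  then have f1: "psi f1 = [:?fr (Var True):]"
    by (simp only: psi.diff[of _ "Const c2 * Var X ^ (q - 1) * Var Z"] z)
       (simp add: psi.diff psi.add psi.mult psi.power w_def)
  have "psi (iota r) = [:?fr r:]" for r
  proof (rule ring_morphism_eqI[where ?h1.0 = "\<lambda>r. psi (iota r)" and ?h2.0 = "\<lambda>r. [:?fr r:]"])
    show "ring_morphism (\<lambda>r. psi (iota r))"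
      by unfold_locales (simp_all add: iota.add iota.mult iota.one psi.add psi.mult psi.one)
    show "ring_morphism (\<lambda>r. [:?fr r:])"
      by unfold_locales (simp_all add: fr.add fr.mult one_pCons One_fract_def del: add_fract mult_fract)
    show "psi (iota (Var v)) = [:?fr (Var v):]" for v
      by (cases v) (simp_all add: f1 x_def)
  qed (simp add: k_def)
  then have map: "psi (phi g) = map_poly ?fr g" for g
    by (induction g) (simp_all add: phi.zero psi.zero phi_pCons psi.add psi.mult map_poly_pCons fr.zero t_def)
  assume "phi g = 0"
  then have "map_poly ?fr g = 0" using map[of g] psi.zero by simp
  then have "?fr (coeff g n) = 0" for n
    by (metis coeff_0 coeff_map_poly fr.zero)
  then show "g = 0" by (simp add: fr0 poly_eq_iff)
qed

lemma phi_surj: "\<exists>n g. Var X ^ n * f = phi g"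
proof (induction f rule: mpoly_induct)
  case (Const c)
  show ?case by (intro exI[of _ 0] exI[of _ "[:Const c:]"]) (simp add: phi_pCons phi.zero)
next
  case (Var v)
  show ?case
  proof (cases v)
    case X
    then show ?thesis by (intro exI[of _ 0] exI[of _ "[:Var False:]"]) (simp add: phi_pCons phi.zero)
  next
    case Y
    then show ?thesis
      by (intro exI[of _ 0] exI[of _ "[:0, 1:]"]) (simp add: phi_pCons phi.zero iota.zero iota.one)
  next
    case Z
    let ?G = "monom 1 q + monom (Const c2 * Var False ^ (q - 2)) 2
      - monom (Const c1 * Var False ^ (q - 1)) 1 - [:Var True:] :: (bool, 'a) mpoly poly"
    have "phi ?G = Const c2 * Var X ^ (q - 1) * Var Z"
      unfolding f1_solve_Z
      by (simp add: phi.diff phi.add phi_monom phi_pCons phi.zero iota.one iota.mult iota.power)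
    moreover have "Const (1 / c2) * Const c2 = (1 :: (xyz, 'a) mpoly)"
      unfolding Const.mult[symmetric] using c2 by simp
    ultimately have "phi ([:Const (1 / c2):] * ?G) = Var X ^ (q - 1) * Var Z"
      unfolding phi.mult by (simp add: phi_pCons phi.zero flip: mult.assoc)
    then show ?thesis unfolding Z by metis
  qed
next
  case (add f g)
  then obtain n a m b where "Var X ^ n * f = phi a" "Var X ^ m * g = phi b" by blast
  moreover have "phi [:Var False:] = Var X" by (simp add: phi_pCons phi.zero)
  moreover have "Var X ^ (n + m) * (f + g) = Var X ^ m * (Var X ^ n * f) + Var X ^ n * (Var X ^ m * g)"
    by (simp add: power_add algebra_simps)
  ultimately have "Var X ^ (n + m) * (f + g) = phi ([:Var False:] ^ m * a + [:Var False:] ^ n * b)"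
    unfolding phi.add phi.mult phi.power by simp
  then show ?case by blast
next
  case (mult f g)
  then obtain n a m b where "Var X ^ n * f = phi a" "Var X ^ m * g = phi b" by blast
  moreover have "Var X ^ (n + m) * (f * g) = (Var X ^ n * f) * (Var X ^ m * g)"
    by (simp add: power_add algebra_simps)
  ultimately have "Var X ^ (n + m) * (f * g) = phi (a * b)"
    unfolding phi.mult by simp
  then show ?case by blast
qed

lemma act_iota: "a \<in> A \<Longrightarrow> act a (iota r) = iota r"
proof (rule ring_morphism_eqI[where ?h1.0 = "\<lambda>r. act a (iota r)" and ?h2.0 = iota])
  assume "a \<in> A"
  then show "act a (iota (Var v)) = iota (Var v)" for v
    using f1_Inv by (cases v) (auto simp: Inv_def)
  show "ring_morphism (\<lambda>r. act a (iota r))"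
    by unfold_locales (simp_all add: iota.add iota.mult iota.one act.add act.mult act.one)
qed (auto intro: iota.ring_morphism_axioms)

lemma act_phi:
  assumes "a \<in> A"
  shows "act a (phi g) = phi (pcompose g [:Const a * Var False, 1:])"
proof -
  have "act a (phi g) = iota.eval_poly (Var Y + Const a * Var X) g" for g
    by (induction g) (simp_all add: phi.zero act.zero phi_pCons act.add act.mult act_iota[OF assms])
  also have "iota.eval_poly (Var Y + Const a * Var X) g = phi (pcompose g [:Const a * Var False, 1:])" for g
    unfolding phi_def iota.eval_poly_pcompose by (simp add: iota.mult iota.one add.commute)
  finally show ?thesis .
qed

definition V :: "(bool, 'a) mpoly set" where
  "V = (\<lambda>a. Const a * Var False) ` A"

definition N :: "(bool, 'a) mpoly poly" where
  "N = (\<Prod>v\<in>V. [:- v, 1:])"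

lemma inj_V: "inj_on (\<lambda>a. Const a * (Var False :: (bool, 'a) mpoly)) A"
proof (rule inj_onI)
  fix a b assume "Const a * Var False = Const b * (Var False :: (bool, 'a) mpoly)"
  with Var_False_nonzero have "Const (a - b) = (0 :: (bool, 'a) mpoly)" by (simp add: Const.diff)
  then show "a = b" by simp
qed

lemma phi_N: "phi N = Ny"
proof -
  have "N = (\<Prod>a\<in>A. [:- (Const a * Var False), 1:])"
    unfolding N_def V_def by (subst prod.reindex[OF inj_V]) simp
  then show ?thesis
    by (simp add: phi.prod Ny_minus phi_pCons phi.zero iota.uminus iota.mult iota.one)
qed

lemma degree_N: "degree N = q * q" "lead_coeff N = 1"
proof -
  show "degree N = q * q"
    unfolding N_def degree_prod_linear_factors(1)
    using A exponent_bounds by (simp add: V_def card_image[OF inj_V])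
  show "lead_coeff N = 1"
    unfolding N_def by (rule degree_prod_linear_factors(2))
qed

text \<open>By injectivity of \<open>phi\<close>, invariance of the image means invariance under translations of the
  variable.\<close>
lemma phi_Inv:
  assumes "phi g \<in> Inv"
  shows "\<exists>s. g = pcompose s N"
  unfolding N_def
proof (rule translation_invariant_poly)
  show "finite V" using A by (simp add: V_def)
  have "0 = Const 0 * (Var False :: (bool, 'a) mpoly)" by simp
  then show "0 \<in> V" using A unfolding V_def by blast
  show "v + w \<in> V" if "v \<in> V" "w \<in> V" for v w
  proof -
    from that obtain a b where "a \<in> A" "b \<in> A" "v = Const a * Var False" "w = Const b * Var False"
      by (auto simp: V_def)
    then show ?thesis
      unfolding V_def using A by (intro image_eqI[of _ _ "a + b"]) (simp_all add: Const.add distrib_right)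
  qed
  show "pcompose g [:v, 1:] = g" if "v \<in> V" for v
  proof -
    obtain a where a: "a \<in> A" "v = Const a * Var False" using \<open>v \<in> V\<close> by (auto simp: V_def)
    then have "phi (pcompose g [:v, 1:] - g) = 0"
      using assms by (auto simp: phi.diff Inv_def act_phi)
    then show ?thesis using phi_inj by fastforce
  qed
qed

text \<open>The norm of \<open>y\<close> as a polynomial of degree one in \<open>h2\<close>.\<close>
definition Ny_in_h2 :: "(bool, 'a) mpoly poly" where
  "Ny_in_h2 = [:Var True ^ q - Const n3 * Var True ^ p * Var False ^ (q * q - p * q)
       - Const (c2 ^ q) * (Var True)\<^sup>2 * Var False ^ (q * q - 2 * q),
     Const (2 * c2 ^ (q + 1)) * Var False ^ (q * q - q - 2):]"

lemma eval_Ny_in_h2: "iota.eval_poly h2 Ny_in_h2 = Ny"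
  by (simp add: Ny_in_h2_def iota.zero iota.diff iota.add iota.mult iota.power Ny_h2_num h2_num_eq algebra_simps)

lemma phi_pcompose_N: "phi (pcompose s N) = iota.eval_poly h2 (pcompose s Ny_in_h2)"
  unfolding iota.eval_poly_pcompose eval_Ny_in_h2 phi_N[symmetric]
  by (simp add: phi_def iota.eval_poly_pcompose)

lemma Inv_in_h2:
  assumes "f \<in> Inv"
  shows "\<exists>n s. Var X ^ n * f = iota.eval_poly h2 s"
proof -
  obtain n g where g: "Var X ^ n * f = phi g" using phi_surj by blast
  have "Var X ^ n * f \<in> Inv"
    by (intro subalgebra_mult subalgebra_power subalgebra_Inv X_Inv assms)
  with g phi_Inv obtain s where "g = pcompose s N" by auto
  with g show ?thesis using phi_pcompose_N by metis
qed

text \<open>Each of the \<open>p\<^sup>4\<close> factors of \<open>N(z)\<close> becomes monic of degree \<open>q\<close> in \<open>y\<close>, so their product is a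
  monic polynomial of degree \<open>q\<close> in \<open>N(y)\<close>, which has degree \<open>p\<^sup>4\<close> in \<open>y\<close>. The leading
  coefficient in \<open>h2\<close> is then a power of that of \<open>N(y)\<close>.\<close>
lemma Nz_in_h2:
  "\<exists>c n s d m. Const c * Var X ^ n * Nz = iota.eval_poly h2 s \<and> degree s = q \<and>
     iota (lead_coeff s) = Const d * Var X ^ m \<and> d \<noteq> 0"
proof -
  let ?x = "Var False :: (bool, 'a) mpoly"
  \<comment> \<open>\<open>c2 x\<^sup>q\<^sup>-\<^sup>1 z = y\<^sup>q - R(y)\<close>, and \<open>R\<close> has degree less than \<open>q\<close> in \<open>y\<close>.\<close>
  define R :: "(bool, 'a) mpoly poly" where
    "R = monom (Const c1 * ?x ^ (q - 1)) 1 + [:Var True:] - monom (Const c2 * ?x ^ (q - 2)) 2"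
  define G where "G = monom 1 q - R"
  have R: "degree R < q"
    unfolding R_def using exponent_bounds
    by (intro degree_add_less degree_diff_less le_less_trans[OF degree_monom_le]) auto
  have "degree (- R) < degree (monom (1 :: (bool, 'a) mpoly) q)" using R by (simp add: degree_monom_eq)
  from degree_add_eq_left[OF this] have dG: "degree G = q" by (simp add: G_def degree_monom_eq)
  have lG: "lead_coeff G = 1" unfolding dG using R by (simp add: G_def coeff_eq_0)
  have phiG: "phi G = Const c2 * Var X ^ (q - 1) * Var Z"
    unfolding f1_solve_Z G_def R_def
    by (simp add: phi.diff phi.add phi_monom phi_pCons phi.zero iota.one iota.mult iota.power)
  define P where "P = (\<Prod>a\<in>A. pcompose G [:Const a * ?x, 1:])"
  have dP: "degree P = q * (q * q)"
  proof -
    have "degree (pcompose G [:Const a * ?x, 1:]) = q" for a by (simp add: degree_pcompose dG)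
    moreover from this have "pcompose G [:Const a * ?x, 1:] \<noteq> 0" for a
      using exponent_bounds by (metis degree_0 not_numeral_le_zero)
    ultimately show ?thesis
      unfolding P_def using A exponent_bounds by (subst degree_prod_sum_eq) auto
  qed
  have lP: "lead_coeff P = 1"
    unfolding P_def lead_coeff_prod by (simp add: lead_coeff_comp lG)
  have "phi P = (\<Prod>a\<in>A. act a (Const c2 * Var X ^ (q - 1) * Var Z))"
    unfolding P_def phi.prod by (rule prod.cong) (simp_all only: act_phi phiG[symmetric])
  also have "\<dots> = (Const c2 * Var X ^ (q - 1)) ^ card A * Nz"
    by (simp add: act.mult act.power prod.distrib Nz_def)
  finally have phiP: "phi P = (Const c2 * Var X ^ (q - 1)) ^ card A * Nz" .
  have "phi P \<in> Inv"
    unfolding phiP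
    by (intro subalgebra_mult subalgebra_power subalgebra_Const subalgebra_Inv X_Inv Nz_Inv)
  then obtain s where s: "P = pcompose s N" using phi_Inv by blast
  have N: "degree N > 0" unfolding degree_N using exponent_bounds by simp
  have ds: "degree s = q"
    using dP N unfolding s degree_pcompose degree_N by simp
  have ls: "lead_coeff s = 1"
    using lP lead_coeff_comp[OF N, of s] unfolding s degree_N(2) by simp
  let ?s = "pcompose s Ny_in_h2"
  have "iota (Const (2 * c2 ^ (q + 1)) * ?x ^ (q * q - q - 2)) \<noteq> 0"
    using c2 two_nonzero X_nonzero by (simp add: iota.mult iota.power)
  then have "Const (2 * c2 ^ (q + 1)) * ?x ^ (q * q - q - 2) \<noteq> 0" using iota.zero by metis
  then have M: "degree Ny_in_h2 = 1" "lead_coeff Ny_in_h2 = Const (2 * c2 ^ (q + 1)) * ?x ^ (q * q - q - 2)"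
    using Var_False_nonzero by (simp_all add: Ny_in_h2_def)
  have "degree ?s = q" unfolding degree_pcompose ds M by simp
  moreover have "lead_coeff ?s = (Const (2 * c2 ^ (q + 1)) * ?x ^ (q * q - q - 2)) ^ q"
  proof -
    have "lead_coeff ?s = lead_coeff s * lead_coeff Ny_in_h2 ^ degree s"
      by (rule lead_coeff_comp) (simp add: M(1))
    then show ?thesis unfolding ls M(2) unfolding ds by simp
  qed
  then have "iota (lead_coeff ?s) = Const ((2 * c2 ^ (q + 1)) ^ q) * Var X ^ ((q * q - q - 2) * q)"
    by (simp only: iota.mult iota.power iota_simps Const.power
        power_mult_distrib[of "Const (2 * c2 ^ (q + 1)) :: (xyz, 'a) mpoly"]
        power_mult_distrib[of "Const (2 * c2 ^ (q + 1)) :: (bool, 'a) mpoly"] power_mult)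
  moreover have "(2 * c2 ^ (q + 1)) ^ q \<noteq> 0" using c2 two_nonzero by simp
  moreover have "Const (c2 ^ card A) * Var X ^ ((q - 1) * card A) * Nz = iota.eval_poly h2 ?s"
    using phiP unfolding s phi_pcompose_N by (simp add: power_mult_distrib power_mult Const.power)
  ultimately show ?thesis by blast
qed

section \<open>The span of the standard products\<close>

text \<open>The index type is that of the vector of generators, in which \<open>4 = 0\<close>.\<close>
definition gen :: "4 \<Rightarrow> (xyz, 'a) mpoly" where
  "gen i = (vector [Var X, f1, h2, Nz] :: (xyz, 'a) mpoly ^ 4) $ i"

lemma gen_simps [simp]: "gen 1 = Var X" "gen 2 = f1" "gen 3 = h2" "gen 4 = Nz"
  by (simp_all add: gen_def vector_def)

lemma gen_Inv: "gen i \<in> Inv"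
  using exhaust_4[of i] X_Inv f1_Inv h2_Inv Nz_Inv by auto

lemma monic_gen: "monic (gen i)"
  using exhaust_4[of i] monic_Var monic_f1 monic_h2 monic_Nz by auto

lemma monic_power_product_gen: "monic (power_product gen I)"
  by (rule monic_power_product) (rule monic_gen)

lemma expo_lead_exp_power_product:
  "expo (lead_exp (power_product gen I)) X = expo I 1"
  "expo (lead_exp (power_product gen I)) Y = q * expo I 2 + (q + 2) * expo I 3"
  "expo (lead_exp (power_product gen I)) Z = q * q * expo I 4"
  by (simp_all add: monic_power_product(2)[OF monic_gen] sum_4 lead_exp_Var lead_exp_f1 lead_exp_h2
      lead_exp_Nz lookup_single)

text \<open>The standard monomials are those with exponent less than \<open>q\<close> in the third variable, which stands
  for \<open>h2\<close>.\<close>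
definition reduced :: "(4, 'a) mpoly \<Rightarrow> bool" where
  "reduced r \<longleftrightarrow> (\<forall>I\<in>Poly_Mapping.keys r. expo I 3 < q)"

definition standard_span :: "(xyz, 'a) mpoly set" where
  "standard_span = subst gen ` {r. reduced r}"

lemma inj_lead_exp:
  assumes "reduced r"
  shows "inj_on (\<lambda>I. lead_exp (power_product gen I)) (Poly_Mapping.keys r)"
proof (rule inj_onI)
  fix I J assume IJ: "I \<in> Poly_Mapping.keys r" "J \<in> Poly_Mapping.keys r"
    "lead_exp (power_product gen I) = lead_exp (power_product gen J)"
  have e: "expo I 1 = expo J 1" "q * expo I 2 + (q + 2) * expo I 3 = q * expo J 2 + (q + 2) * expo J 3"
    "q * q * expo I 4 = q * q * expo J 4"
    unfolding expo_lead_exp_power_product[symmetric] IJ(3) by (rule refl)+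
  have lt: "expo I 3 < q" "expo J 3 < q" using assms IJ by (auto simp: reduced_def)
  \<comment> \<open>Modulo the odd number \<open>q\<close> the exponent of \<open>y\<close> is twice the third exponent, which is less than \<open>q\<close>.\<close>
  have "int (q * expo I 2 + (q + 2) * expo I 3) = int (q * expo J 2 + (q + 2) * expo J 3)"
    using e(2) by (rule arg_cong)
  then have "2 * (int (expo J 3) - int (expo I 3)) =
      int q * (int (expo I 2) + int (expo I 3) - int (expo J 2) - int (expo J 3))"
    by (simp add: algebra_simps)
  then have "int q dvd 2 * (int (expo J 3) - int (expo I 3))" by simp
  moreover have "odd q" using p prime_odd_nat by (simp add: q_def)
  then have "coprime (int q) 2" by simp
  ultimately have "int q dvd int (expo J 3) - int (expo I 3)"
    by (simp only: coprime_dvd_mult_right_iff)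
  note dvd = this
  have 3: "expo I 3 = expo J 3"
  proof (rule ccontr)
    assume "expo I 3 \<noteq> expo J 3"
    then have "\<bar>int q\<bar> \<le> \<bar>int (expo J 3) - int (expo I 3)\<bar>"
      by (intro dvd_imp_le_int dvd) simp
    with lt show False by linarith
  qed
  have "q \<noteq> 0" using exponent_bounds by simp
  then have "expo I 2 = expo J 2" "expo I 4 = expo J 4"
    using e(2,3) unfolding 3 by simp_all
  with e(1) 3 show "I = J" by (intro poly_mapping_eqI) (metis exhaust_4)
qed

lemma reduced_lead_exp:
  assumes "reduced r" "r \<noteq> 0"
  obtains I where "I \<in> Poly_Mapping.keys r" "subst gen r \<noteq> 0"
    "lead_exp (subst gen r) = lead_exp (power_product gen I)"
  using lead_exp_subst[OF monic_power_product_gen inj_lead_exp[OF assms(1)] assms(2)] by blast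

lemma standard_span_0: "0 \<in> standard_span"
  by (auto simp: standard_span_def reduced_def subst.zero intro!: image_eqI[of _ _ 0])

lemma standard_span_add: "f \<in> standard_span \<Longrightarrow> g \<in> standard_span \<Longrightarrow> f + g \<in> standard_span"
proof -
  assume "f \<in> standard_span" "g \<in> standard_span"
  then obtain r s where "f = subst gen r" "g = subst gen s" "reduced r" "reduced s" by (auto simp: standard_span_def)
  moreover from this have "reduced (r + s)"
    using Poly_Mapping.keys_add[of r s] by (auto simp: reduced_def)
  ultimately show ?thesis by (auto simp: standard_span_def subst.add intro!: image_eqI[of _ _ "r + s"])
qed

lemma standard_span_sum: "(\<And>i. i \<in> S \<Longrightarrow> f i \<in> standard_span) \<Longrightarrow> sum f S \<in> standard_span"
  by (induction S rule: infinite_finite_induct) (auto intro: standard_span_0 standard_span_add)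

lemma standard_span_mult_reduced_monomial:
  assumes "f \<in> standard_span" "expo I 3 = 0"
  shows "Const c * power_product gen I * f \<in> standard_span"
proof -
  obtain r where r: "f = subst gen r" "reduced r" using assms by (auto simp: standard_span_def)
  have "reduced (Poly_Mapping.single I c * r)"
    unfolding reduced_def
  proof
    fix K assume "K \<in> Poly_Mapping.keys (Poly_Mapping.single I c * r)"
    with keys_mult[of "Poly_Mapping.single I c" r] obtain L where "K = I + L" "L \<in> Poly_Mapping.keys r"
      by (auto split: if_splits)
    with r assms show "expo K 3 < q" by (auto simp: reduced_def lookup_add)
  qed
  then show ?thesis
    by (auto simp: standard_span_def r subst.mult subst_single intro!: image_eqI[of _ _ "Poly_Mapping.single I c * r"])
qed

lemma standard_span_Const_mult: "f \<in> standard_span \<Longrightarrow> Const c * f \<in> standard_span"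
  using standard_span_mult_reduced_monomial[of f 0 c] by simp

lemma standard_span_mult_gen: "f \<in> standard_span \<Longrightarrow> i \<noteq> 3 \<Longrightarrow> gen i * f \<in> standard_span"
  using standard_span_mult_reduced_monomial[of f "Poly_Mapping.single i 1" 1] by (simp add: lookup_single)

lemma standard_span_power_product: "expo I 3 < q \<Longrightarrow> power_product gen I \<in> standard_span"
  by (auto simp: standard_span_def reduced_def subst_single intro!: image_eqI[of _ _ "Poly_Mapping.single I 1"])

lemma standard_span_X_power: "f \<in> standard_span \<Longrightarrow> Var X ^ n * f \<in> standard_span"
  by (induction n) (use standard_span_mult_gen[of _ 1] in \<open>auto simp: mult.assoc\<close>)

lemma standard_span_iota: "f \<in> standard_span \<Longrightarrow> iota r * f \<in> standard_span"
proof (induction r arbitrary: f rule: mpoly_induct)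
  case (Const c) then show ?case by (simp add: standard_span_Const_mult)
next
  case (Var v) then show ?case using standard_span_mult_gen[of f 1] standard_span_mult_gen[of f 2] by (cases v) auto
next
  case (add r s) then show ?case by (simp add: iota.add distrib_right standard_span_add)
next
  case (mult r s) then show ?case by (simp add: iota.mult mult.assoc)
qed

lemma standard_span_Inv: "standard_span \<subseteq> Inv"
  by (auto simp: standard_span_def intro: subalgebra_subst subalgebra_Inv gen_Inv)

text \<open>Products without the factor \<open>x\<close> have lead monomials prime to \<open>x\<close>, so a combination of them is a
  multiple of \<open>x\<close> only if it vanishes.\<close>
lemma standard_span_cancel_X:
  assumes "Var X * f \<in> standard_span"
  shows "f \<in> standard_span"
proof -
  obtain r where r: "Var X * f = subst gen r" "reduced r" using assms by (auto simp: standard_span_def)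
  let ?K = "Poly_Mapping.keys r" and ?c = "Poly_Mapping.lookup r"
  define r0 where "r0 = (\<Sum>I\<in>{I \<in> ?K. expo I 1 = 0}. Poly_Mapping.single I (?c I))"
  define g where "g = (\<Sum>I\<in>{I \<in> ?K. expo I 1 \<noteq> 0}. Const (?c I) * power_product gen (I - Poly_Mapping.single 1 1))"
  have "subst gen r = (\<Sum>I\<in>{I \<in> ?K. expo I 1 = 0} \<union> {I \<in> ?K. expo I 1 \<noteq> 0}. Const (?c I) * power_product gen I)"
    unfolding subst_def by (rule sum.cong) auto
  also have "\<dots> = (\<Sum>I\<in>{I \<in> ?K. expo I 1 = 0}. Const (?c I) * power_product gen I) +
      (\<Sum>I\<in>{I \<in> ?K. expo I 1 \<noteq> 0}. Const (?c I) * power_product gen I)"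
    by (rule sum.union_disjoint) auto
  also have "(\<Sum>I\<in>{I \<in> ?K. expo I 1 \<noteq> 0}. Const (?c I) * power_product gen I) = Var X * g"
    unfolding g_def sum_distrib_left
  proof (rule sum.cong)
    fix I assume "I \<in> {I \<in> ?K. expo I 1 \<noteq> 0}"
    then have "Poly_Mapping.single 1 1 + (I - Poly_Mapping.single 1 1) = I"
      by (intro poly_mapping_eqI) (auto simp: lookup_add lookup_minus lookup_single when_def)
    then have "power_product gen I = Var X * power_product gen (I - Poly_Mapping.single 1 1)"
      using power_product_add[of gen "Poly_Mapping.single 1 1" "I - Poly_Mapping.single 1 1"] by simp
    then show "Const (?c I) * power_product gen I = Var X * (Const (?c I) * power_product gen (I - Poly_Mapping.single 1 1))"
      by (simp add: ac_simps)
  qed simp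
  also have "(\<Sum>I\<in>{I \<in> ?K. expo I 1 = 0}. Const (?c I) * power_product gen I) = subst gen r0"
    by (simp add: r0_def subst.sum subst_single)
  finally have eq: "Var X * (f - g) = subst gen r0" unfolding r(1)[symmetric] by (simp add: algebra_simps)
  have K0: "Poly_Mapping.keys r0 \<subseteq> {I \<in> ?K. expo I 1 = 0}"
    unfolding r0_def using keys_sum[of "\<lambda>I. Poly_Mapping.single I (?c I)"] by (fastforce split: if_splits)
  \<comment> \<open>The lead monomials of the summands of \<open>r0\<close> do not contain \<open>x\<close>, that of a multiple of \<open>x\<close> does.\<close>
  have "r0 = 0"
  proof (rule ccontr)
    assume "r0 \<noteq> 0"
    moreover have "reduced r0" using K0 r(2) by (auto simp: reduced_def)
    ultimately obtain I where I: "I \<in> Poly_Mapping.keys r0" "subst gen r0 \<noteq> 0"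
      "lead_exp (subst gen r0) = lead_exp (power_product gen I)" using reduced_lead_exp by blast
    then have "f - g \<noteq> 0" using eq by auto
    then have "expo (lead_exp (subst gen r0)) X = 1 + expo (lead_exp (f - g)) X"
      unfolding eq[symmetric] using X_nonzero by (simp add: lead_exp_mult lead_exp_Var lookup_add)
    moreover have "expo (lead_exp (subst gen r0)) X = 0" using I K0 by (auto simp: expo_lead_exp_power_product)
    ultimately show False by simp
  qed
  with eq X_nonzero have "f = g" by (simp add: subst.zero)
  moreover have "g \<in> standard_span"
    unfolding g_def by (intro standard_span_sum standard_span_Const_mult standard_span_power_product) (use r(2) in \<open>auto simp: reduced_def lookup_minus\<close>)
  ultimately show ?thesis by simp
qed

lemma standard_span_cancel_X_power: "Var X ^ n * f \<in> standard_span \<Longrightarrow> f \<in> standard_span"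
proof (induction n)
  case (Suc n)
  then show ?case using standard_span_cancel_X[of "Var X ^ n * f"] by (simp add: mult.assoc)
qed simp

lemma h2_power: "h2 ^ k = power_product gen (Poly_Mapping.single 3 k)"
  by simp

lemma standard_span_h2_power: "k < q \<Longrightarrow> h2 ^ k \<in> standard_span"
  unfolding h2_power by (rule standard_span_power_product) simp

text \<open>In the expression of \<open>N(z)\<close> of degree \<open>q\<close> in \<open>h2\<close> the leading coefficient is a scalar times a
  power of \<open>x\<close>; solve for \<open>h2\<^sup>q\<close> and cancel.\<close>
lemma standard_span_h2_power_q: "h2 ^ q \<in> standard_span"
proof -
  obtain c n s d m where s: "Const c * Var X ^ n * Nz = iota.eval_poly h2 s" "degree s = q"
    "iota (lead_coeff s) = Const d * Var X ^ m" "d \<noteq> 0" using Nz_in_h2 by blast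
  let ?r = "\<Sum>k<q. iota (coeff s k) * h2 ^ k"
  have "iota.eval_poly h2 s = (\<Sum>k<Suc q. iota (coeff s k) * h2 ^ k)"
    unfolding iota.eval_poly_altdef s(2) lessThan_Suc_atMost ..
  then have "Const d * (Var X ^ m * h2 ^ q) = Const c * (Var X ^ n * Nz) + Const (- 1) * ?r"
    using s by (simp add: Const.uminus mult.assoc)
  also have "\<dots> \<in> standard_span"
  proof (intro standard_span_add standard_span_Const_mult standard_span_X_power standard_span_sum standard_span_iota standard_span_h2_power)
    show "Nz \<in> standard_span" using standard_span_power_product[of "Poly_Mapping.single 4 1"] exponent_bounds by (simp add: lookup_single)
  qed simp
  finally have "Const (1 / d) * (Const d * (Var X ^ m * h2 ^ q)) \<in> standard_span" by (rule standard_span_Const_mult)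
  moreover have "Const (1 / d) * Const d = (1 :: (xyz, 'a) mpoly)"
    unfolding Const.mult[symmetric] using s(4) by simp
  ultimately have "Var X ^ m * h2 ^ q \<in> standard_span" by (simp flip: mult.assoc)
  then show ?thesis by (rule standard_span_cancel_X_power)
qed

lemma standard_span_h2_mult: "f \<in> standard_span \<Longrightarrow> h2 * f \<in> standard_span"
proof -
  assume "f \<in> standard_span"
  then obtain r where r: "f = subst gen r" "reduced r" by (auto simp: standard_span_def)
  have "Const c * (h2 * power_product gen I) \<in> standard_span" if "expo I 3 < q" for I c
  proof (cases "expo I 3 + 1 < q")
    case True
    have "h2 * power_product gen I = power_product gen (Poly_Mapping.single 3 1 + I)"
      by (simp add: power_product_add)
    then show ?thesis using True by (simp only:) (intro standard_span_Const_mult standard_span_power_product, simp add: lookup_add)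
  next
    case False
    define J where "J = I - Poly_Mapping.single 3 (q - 1)"
    have I: "I = Poly_Mapping.single 3 (q - 1) + J" and J: "expo J 3 = 0"
      using False that
      by (auto simp: J_def lookup_add lookup_minus lookup_single when_def intro!: poly_mapping_eqI)
    have "h2 * h2 ^ (q - 1) = h2 ^ q" using exponent_bounds by (simp flip: power_Suc)
    then have "Const c * (h2 * power_product gen I) = Const c * power_product gen J * h2 ^ q"
      unfolding I power_product_add power_product_single by (simp add: ac_simps)
    then show ?thesis using standard_span_mult_reduced_monomial[OF standard_span_h2_power_q J] by (simp only:)
  qed
  then have "(\<Sum>I\<in>Poly_Mapping.keys r. Const (Poly_Mapping.lookup r I) * (h2 * power_product gen I)) \<in> standard_span"
    using r(2) by (intro standard_span_sum) (auto simp: reduced_def)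
  then show ?thesis by (simp add: r subst_def sum_distrib_left ac_simps)
qed

text \<open>A power of \<open>x\<close> times an invariant is a polynomial in \<open>h2\<close> over \<open>F[x, f1]\<close>, hence lies in the
  span, and the power of \<open>x\<close> can be cancelled there.\<close>
lemma Inv_eq_standard_span: "Inv = standard_span"
proof
  show "Inv \<subseteq> standard_span"
  proof
    fix f assume "f \<in> Inv"
    then obtain n s where ns: "Var X ^ n * f = iota.eval_poly h2 s" using Inv_in_h2 by blast
    have "1 \<in> standard_span" using standard_span_h2_power[of 0] exponent_bounds by simp
    then have "h2 ^ k \<in> standard_span" for k by (induction k) (auto intro: standard_span_h2_mult)
    then have "Var X ^ n * f \<in> standard_span"
      unfolding ns iota.eval_poly_altdef by (intro standard_span_sum standard_span_iota)
    then show "f \<in> standard_span" by (rule standard_span_cancel_X_power)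
  qed
qed (rule standard_span_Inv)

lemma lead_exps_Inv: "lead_exps_generated gen Inv"
  unfolding lead_exps_generated_def
proof (intro ballI impI)
  fix f assume "f \<in> Inv" "f \<noteq> 0"
  then obtain r where r: "f = subst gen r" "reduced r" by (auto simp: Inv_eq_standard_span standard_span_def)
  with \<open>f \<noteq> 0\<close> have "r \<noteq> 0" by (auto simp: subst.zero)
  with r reduced_lead_exp show "\<exists>I. lead_exp f = lead_exp (power_product gen I)" by metis
qed

lemma sagbi_basis_gen: "sagbi_basis (range gen) Inv"
  by (rule sagbi_basisI[OF subalgebra_Inv gen_Inv monic_nonzero[OF monic_gen] lead_exps_Inv])

section \<open>The relation\<close>

abbreviation "I0 \<equiv> Poly_Mapping.single (3::4) q"
abbreviation "J0 \<equiv> Poly_Mapping.single (2::4) (q + 2)"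

lemma lead_exp_tete: "lead_exp (power_product gen I0) = Poly_Mapping.single Y (q * (q + 2))"
  "lead_exp (power_product gen J0) = Poly_Mapping.single Y (q * (q + 2))"
  by (rule xyz_exponent_eqI; simp add: expo_lead_exp_power_product lookup_single del: power_product_single)+

lemma tete_a_tete_exists: "\<exists>R. tete_a_tete_relation gen I0 J0 R"
proof -
  have "power_product gen I0 - Const 1 * power_product gen J0 \<in> Inv"
    by (intro subalgebra_minus subalgebra_mult subalgebra_Const subalgebra_power_product
        subalgebra_Inv gen_Inv)
  from subducts_to_zero_exists[OF subalgebra_Inv gen_Inv monic_power_product_gen lead_exps_Inv this]
  obtain Q where "subducts_to_zero gen (power_product gen I0 - Const 1 * power_product gen J0) Q"
    by blast
  moreover have "LM (power_product gen I0) = LM (power_product gen J0)"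
    unfolding LM_def lead_exp_tete ..
  moreover have "LT (power_product gen I0) = LT (Const 1 * power_product gen J0)"
    using monic_power_product_gen[of I0] monic_power_product_gen[of J0] unfolding monic_def LT_def Const_1 mult_1
    by (simp only: lead_exp_tete)
  ultimately show ?thesis unfolding tete_a_tete_relation_def by blast
qed

lemma reduced_add: "reduced r \<Longrightarrow> reduced s \<Longrightarrow> reduced (r + s)"
  using Poly_Mapping.keys_add[of r s] by (auto simp: reduced_def)

text \<open>The choices made in the subduction do not matter: all products used have lead monomials smaller
  than that of \<open>h2\<^sup>q\<close>, so the relation has lead term \<open>h2\<^sup>q\<close> as a polynomial in the third
  variable, and remainders of division by it are reduced.\<close>
lemma tete_a_tete_hypersurface:
  assumes "tete_a_tete_relation gen I0 J0 R"
  shows "hypersurface_with_relation gen Inv R"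
proof -
  obtain c Q where LT: "LT (power_product gen I0) = LT (Const c * power_product gen J0)"
    and Q: "subducts_to_zero gen (power_product gen I0 - Const c * power_product gen J0) Q"
    and R: "R = Poly_Mapping.single I0 1 - Poly_Mapping.single J0 c - Q"
    using assms unfolding tete_a_tete_relation_def by blast
  have "LT (power_product gen I0) \<noteq> 0"
    using Const_mult_nonzero_monic[OF one_neq_zero monic_power_product_gen[of I0]]
    by (metis Const_1 lookup_single_eq lookup_zero mult_1 zero_neq_one)
  with LT have c: "c \<noteq> 0" by (auto simp: LT_def)
  have "keys_below (lead_exp (power_product gen I0)) (power_product gen I0 - Const c * power_product gen J0)"
    using lead_term_cancel(2)[OF monic_nonzero[OF monic_power_product_gen] _ LT] Const_mult_nonzero_monic[OF c monic_power_product_gen] by blast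
  from subducts_to_zero_keys[OF monic_power_product_gen Q this]
  have Qless: "grevlex_less (lead_exp (power_product gen K)) (Poly_Mapping.single Y (q * (q + 2)))"
    if "K \<in> Poly_Mapping.keys Q" for K using that unfolding lead_exp_tete .
  have Qred: "reduced Q"
    unfolding reduced_def
  proof
    fix K assume "K \<in> Poly_Mapping.keys Q"
    note less = Qless[OF this]
    show "expo K 3 < q"
    proof (rule ccontr)
      assume "\<not> expo K 3 < q"
      then have "(q + 2) * q \<le> (q + 2) * expo K 3" by (intro mult_le_mono2) simp
      with less show False
        by (auto simp: grevlex_less_iff total_degree_xyz expo_lead_exp_power_product lookup_single mult.commute[of q "q + 2"])
    qed
  qed
  have R0: "subst gen R = 0"
    using subducts_to_zero_subst[OF Q] unfolding R by (simp add: subst.diff subst_single)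
  \<comment> \<open>Division with remainder by \<open>R\<close>, which is monic of degree \<open>q\<close> in the third variable.\<close>
  define D where "D = {t. \<exists>s r. t = R * s + r \<and> reduced r}"
  have D_add: "t + u \<in> D" if tu: "t \<in> D" "u \<in> D" for t u
  proof -
    obtain s r s' r' where "t = R * s + r" "u = R * s' + r'" "reduced r" "reduced r'"
      using tu by (auto simp: D_def)
    then have "t + u = R * (s + s') + (r + r')" "reduced (r + r')"
      by (simp_all add: algebra_simps reduced_add)
    then show ?thesis unfolding D_def by blast
  qed
  have D_0: "0 \<in> D" by (auto simp: D_def reduced_def intro!: exI[of _ 0])
  have D_sum: "sum t S \<in> D" if "\<And>i. i \<in> S \<Longrightarrow> t i \<in> D" for t and S :: "(4 \<Rightarrow>\<^sub>0 nat) set"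
    using that by (induction S rule: infinite_finite_induct) (auto intro: D_0 D_add)
  have D_single: "Poly_Mapping.single K d \<in> D" for K d
  proof (induction "expo K 3" arbitrary: K d rule: less_induct)
    case less
    show ?case
    proof (cases "expo K 3 < q")
      case True
      then have "reduced (Poly_Mapping.single K d)" by (auto simp: reduced_def)
      moreover have "Poly_Mapping.single K d = R * 0 + Poly_Mapping.single K d" by simp
      ultimately show ?thesis unfolding D_def by blast
    next
      case False
      define L where "L = K - I0"
      have K: "K = I0 + L"
        using False by (auto simp: L_def lookup_add lookup_minus lookup_single when_def intro!: poly_mapping_eqI)
      let ?P = "Poly_Mapping.single J0 c + Q"
      let ?u = "?P * Poly_Mapping.single L d"
      have "Poly_Mapping.single K d = Poly_Mapping.single I0 1 * Poly_Mapping.single L d"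
        by (simp add: K mult_single)
      also have "Poly_Mapping.single I0 1 = R + ?P" by (simp add: R)
      finally have eq: "Poly_Mapping.single K d = R * Poly_Mapping.single L d + ?u"
        by (simp add: algebra_simps)
      have "expo m 3 < expo K 3" if m: "m \<in> Poly_Mapping.keys ?u" for m
      proof -
        obtain a where a: "m = a + L" "a \<in> Poly_Mapping.keys ?P"
          using m keys_mult[of ?P "Poly_Mapping.single L d"] by (auto split: if_splits)
        moreover have "reduced ?P"
          using exponent_bounds by (intro reduced_add Qred) (auto simp: reduced_def lookup_single)
        ultimately show ?thesis by (auto simp: reduced_def K lookup_add)
      qed
      then have "(\<Sum>m\<in>Poly_Mapping.keys ?u. Poly_Mapping.single m (Poly_Mapping.lookup ?u m)) \<in> D"
        by (intro D_sum less) 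
      then have "?u \<in> D" by (simp flip: sum_single_lookup)
      moreover have "R * Poly_Mapping.single L d \<in> D"
        unfolding D_def
        by (rule CollectI, rule exI[of _ "Poly_Mapping.single L d"], rule exI[of _ 0]) (simp add: reduced_def)
      ultimately show ?thesis unfolding eq by (intro D_add)
    qed
  qed
  have D_all: "t \<in> D" for t
    using D_sum[of "Poly_Mapping.keys t" "\<lambda>m. Poly_Mapping.single m (Poly_Mapping.lookup t m)"] D_single
    by (simp flip: sum_single_lookup)
  have "R dvd t" if t: "subst gen t = 0" for t
  proof -
    obtain s r where sr: "t = R * s + r" "reduced r" using D_all[of t] by (auto simp: D_def)
    then have "subst gen r = 0" using t by (simp add: subst.add subst.mult R0)
    then have "r = 0" using reduced_lead_exp[OF sr(2)] by metis
    with sr show ?thesis by simp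
  qed
  moreover have "subst gen t = 0" if "R dvd t" for t
    using that by (auto simp: dvd_def subst.mult R0)
  moreover have "range (subst gen) = Inv"
    using subalgebra_subst[OF subalgebra_Inv gen_Inv] by (auto simp: Inv_eq_standard_span standard_span_def)
  ultimately show ?thesis unfolding hypersurface_with_relation_def by blast
qed

end

section \<open>Linear algebra of the minors\<close>

lemma det_swap_rows:
  fixes B :: "'a::comm_ring_1^'n^'n"
  assumes "a \<noteq> b"
  shows "det (\<chi> i. B $ Transposition.transpose a b i) = - det B"
  using det_permute_rows[of "Transposition.transpose a b" B] assms
  by (simp add: permutes_swap_id sign_swap_id)

lemma det_swap_adjacent:
  fixes u v w x :: "'a::comm_ring_1^4"
  shows "det (vector [v, u, w, x] :: 'a^4^4) = - det (vector [u, v, w, x] :: 'a^4^4)"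
    "det (vector [u, w, v, x] :: 'a^4^4) = - det (vector [u, v, w, x] :: 'a^4^4)"
    "det (vector [u, v, x, w] :: 'a^4^4) = - det (vector [u, v, w, x] :: 'a^4^4)"
proof -
  have "vector [v, u, w, x] = (\<chi> i. (vector [u, v, w, x] :: 'a^4^4) $ Transposition.transpose 1 2 i)"
    "vector [u, w, v, x] = (\<chi> i. (vector [u, v, w, x] :: 'a^4^4) $ Transposition.transpose 2 3 i)"
    "vector [u, v, x, w] = (\<chi> i. (vector [u, v, w, x] :: 'a^4^4) $ Transposition.transpose 3 4 i)"
    unfolding vec_eq_iff forall_4 by (simp_all add: vector_def Transposition.transpose_def)
  then show "det (vector [v, u, w, x] :: 'a^4^4) = - det (vector [u, v, w, x] :: 'a^4^4)"
    "det (vector [u, w, v, x] :: 'a^4^4) = - det (vector [u, v, w, x] :: 'a^4^4)"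
    "det (vector [u, v, x, w] :: 'a^4^4) = - det (vector [u, v, w, x] :: 'a^4^4)"
    by (simp_all add: det_swap_rows)
qed

text \<open>Cramer's rule, transposed.\<close>
lemma det_replace_row:
  fixes B :: "'a::field^'n^'n"
  assumes "\<And>j. r $ j = (\<Sum>i\<in>UNIV. c $ i * B $ i $ j)"
  shows "det (\<chi> i. if i = k then r else B $ i) = c $ k * det B"
proof -
  have r: "transpose B *v c = r"
    unfolding vec_eq_iff matrix_vector_mult_def transpose_def by (simp add: assms mult.commute)
  have "det (\<chi> i. if i = k then r else B $ i) = det (transpose (\<chi> i. if i = k then r else B $ i))"
    by (simp add: det_transpose)
  also have "transpose (\<chi> i. if i = k then r else B $ i) =
      (\<chi> i j. if j = k then (transpose B *v c) $ i else transpose B $ i $ j)"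
    unfolding r by (simp add: vec_eq_iff transpose_def)
  finally show ?thesis unfolding cramer_lemma by (simp add: det_transpose)
qed

lemma row_combination_exists:
  fixes B :: "'a::field^'n^'n"
  assumes "det B \<noteq> 0"
  obtains c where "\<And>j. r $ j = (\<Sum>i\<in>UNIV. c $ i * B $ i $ j)"
proof -
  have "det (transpose B) \<noteq> 0" using assms by (simp add: det_transpose)
  from cramer[OF this, of _ r] obtain c where "transpose B *v c = r" by blast
  then have "r $ j = (\<Sum>i\<in>UNIV. c $ i * B $ i $ j)" for j
    by (auto simp: matrix_vector_mult_def transpose_def mult.commute)
  then show thesis using that by blast
qed

lemma combination_of_four_rows:
  fixes u v w x r :: "'a::field^4"
  assumes "det (vector [u, v, w, x] :: 'a^4^4) \<noteq> 0"
  obtains c1 c2 c3 c4 where "\<And>j. r $ j = c1 * u $ j + c2 * v $ j + c3 * w $ j + c4 * x $ j"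
    "det (vector [r, v, w, x] :: 'a^4^4) = c1 * det (vector [u, v, w, x] :: 'a^4^4)"
    "det (vector [u, r, w, x] :: 'a^4^4) = c2 * det (vector [u, v, w, x] :: 'a^4^4)"
    "det (vector [u, v, r, x] :: 'a^4^4) = c3 * det (vector [u, v, w, x] :: 'a^4^4)"
    "det (vector [u, v, w, r] :: 'a^4^4) = c4 * det (vector [u, v, w, x] :: 'a^4^4)"
proof -
  let ?B = "vector [u, v, w, x] :: 'a^4^4"
  obtain c where c: "\<And>j. r $ j = (\<Sum>i\<in>UNIV. c $ i * ?B $ i $ j)"
    using row_combination_exists[OF assms, of r] by blast
  have "(\<chi> i. if i = 1 then r else ?B $ i) = vector [r, v, w, x]"
    "(\<chi> i. if i = 2 then r else ?B $ i) = vector [u, r, w, x]"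
    "(\<chi> i. if i = 3 then r else ?B $ i) = vector [u, v, r, x]"
    "(\<chi> i. if i = 4 then r else ?B $ i) = vector [u, v, w, r]"
    unfolding vec_eq_iff[where 'b = 4] forall_4 by (simp_all add: vector_def)
  with det_replace_row[OF c, of 1] det_replace_row[OF c, of 2] det_replace_row[OF c, of 3]
    det_replace_row[OF c, of 4]
  show thesis
    by (intro that[of "c $ 1" "c $ 2" "c $ 3" "c $ 4"]) (simp_all add: c sum_4, simp_all add: vector_def)
qed

section \<open>The group of the matrix\<close>

lemma carrier_elem_abelian4:
  "p > 0 \<Longrightarrow> g \<in> carrier (elem_abelian4 p) \<longleftrightarrow> (\<forall>j. 0 \<le> g j \<and> g j < int p)"
  by (auto simp: elem_abelian4_def carrier_product_group carrier_integer_mod_group PiE_iff)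

lemma card_carrier_elem_abelian4:
  assumes "p > 0"
  shows "finite (carrier (elem_abelian4 p))" "card (carrier (elem_abelian4 p)) = p ^ 4"
  using assms
  by (simp_all add: elem_abelian4_def carrier_product_group carrier_integer_mod_group finite_PiE card_PiE)

definition E_comb :: "(4 \<Rightarrow> 'a::field) \<Rightarrow> (4 \<Rightarrow> int) \<Rightarrow> 'a" where
  "E_comb a g = (\<Sum>j\<in>UNIV. of_int (g j) * a j)"

lemma translation_funpow:
  "(translation a b ^^ n) f = translation (of_nat n * a) (of_nat n * b) f"
  by (induction n) (simp_all add: translation_0 translation_translation algebra_simps)

lemma E_act_eq_translation:
  assumes "p > 0" "g \<in> carrier (elem_abelian4 p)"
  shows "E_act M g f = translation (E_comb (($) (M $ 1)) g) (E_comb (($) (M $ 2)) g) f"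
proof -
  have gen: "gen_act M j = translation (M $ 1 $ j) (M $ 2 $ j)" for j
    by (rule ext) (simp add: gen_act_def translation_def)
  have "of_nat (nat (g j)) = (of_int (g j) :: 'a)" for j
    using assms by (simp add: carrier_elem_abelian4)
  then show ?thesis
    by (simp add: E_act_def gen translation_funpow translation_translation E_comb_def sum_4 ac_simps)
qed

lemma of_int_power_char:
  assumes "prime p" "CHAR('a::field) = p"
  shows "(of_int k :: 'a) ^ (p ^ n) = of_int k"
proof -
  have nat: "(of_nat m :: 'a) ^ (p ^ n) = of_nat m" for m
    using assms(1) by (induction m) (simp_all add: power_char_add[OF assms] prime_gt_0_nat)
  show ?thesis
  proof (cases k)
    case (nonneg m) then show ?thesis by (simp add: nat)
  next
    case (neg m)
    then show ?thesis
      using power_char_diff[OF assms, of 0 "of_nat (Suc m) :: 'a" n] nat[of "Suc m"] assms(1)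
      by (simp add: prime_gt_0_nat del: of_nat_Suc)
  qed
qed

lemma E_comb_power:
  fixes a :: "4 \<Rightarrow> 'a::field"
  assumes "prime p" "CHAR('a) = p"
  shows "E_comb a g ^ (p ^ n) = E_comb (\<lambda>j. a j ^ (p ^ n)) g"
  unfolding E_comb_def
  by (subst freshmans_dream_sum'[where n = n])
     (use assms in \<open>simp_all add: power_mult_distrib of_int_power_char\<close>)

text \<open>Taking \<open>p\<close>-th powers fixes coefficients in the prime field, so a relation among the entries of the
  first row holds for the rows 1, 3, 5 and 7, whose minor is not zero.\<close>
lemma E_comb_zeroD:
  fixes M :: "'a::field^4^2"
  assumes p: "prime p" "CHAR('a) = p" and g: "minor p M 1 3 5 7 \<noteq> 0"
    and 0: "E_comb (($) (M $ 1)) k = 0"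
  shows "of_int (k j) = (0::'a)"
proof -
  let ?B = "vector [Gamma_row p M 1, Gamma_row p M 3, Gamma_row p M 5, Gamma_row p M 7] :: 'a^4^4"
  define x :: "'a^4" where "x = (\<chi> j. of_int (k j))"
  have pow: "(\<Sum>j\<in>UNIV. M $ 1 $ j ^ (p ^ n) * of_int (k j)) = 0" for n
    using E_comb_power[OF p, of "($) (M $ 1)" k n] 0
      prime_gt_0_nat[OF p(1)] by (simp add: E_comb_def mult.commute power_0_left)
  have "?B *v x = 0"
    unfolding vec_eq_iff forall_4
    using pow[of 0] pow[of 1] pow[of 2] pow[of 3]
    by (simp add: matrix_vector_mult_def x_def vector_def Gamma_row_def)
  moreover have "?B *v 0 = 0" by simp
  moreover have "det ?B \<noteq> 0" using g by (simp add: minor_def)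
  ultimately have "x = 0" using cramer[of ?B x 0] cramer[of ?B 0 0] by metis
  then show ?thesis by (simp add: x_def vec_eq_iff)
qed

theorem theorem5p6:
  fixes p :: nat and M :: "'a::field^4^2"
  assumes "prime p" and "p > 2" and "CHAR('a) = p"
    and "minor p M 1 2 3 4 \<noteq> 0"
    and "minor p M 1 2 3 5 = 0"
    and "minor p M 1 3 5 7 \<noteq> 0"
    and "minor p M 1 2 4 5 = 0"
  shows "sagbi_basis {Var X, f1_hat p M, h2_hat p M, orbit_product p M (Var Z)} (E_invariants p M) \<and>
    (let b = (\<lambda>i. generators p M $ i);
         I = Poly_Mapping.single 3 (p^2);
         J = Poly_Mapping.single 2 (p^2 + 2)
     in (\<exists>R. tete_a_tete_relation b I J R) \<and>
        (\<forall>R. tete_a_tete_relation b I J R \<longrightarrow>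
             hypersurface_with_relation b (E_invariants p M) R))"
proof -
  note pc = assms(1,3) and g = assms(4-7)
  let ?G = "carrier (elem_abelian4 p)"
  let ?a = "($) (M $ 1)" and ?b = "($) (M $ 2)"
  have p0: "p > 0" using assms(2) by simp
  obtain c1 c2 c3 c4 where
    row5: "\<And>j. Gamma_row p M 5 $ j = c1 * Gamma_row p M 1 $ j + c2 * Gamma_row p M 2 $ j
       + c3 * Gamma_row p M 3 $ j + c4 * Gamma_row p M 4 $ j"
    and c: "minor p M 5 2 3 4 = c1 * minor p M 1 2 3 4" "minor p M 1 5 3 4 = c2 * minor p M 1 2 3 4"
      "minor p M 1 2 5 4 = c3 * minor p M 1 2 3 4" "minor p M 1 2 3 5 = c4 * minor p M 1 2 3 4"
    using combination_of_four_rows[of "Gamma_row p M 1" "Gamma_row p M 2" "Gamma_row p M 3"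
        "Gamma_row p M 4" "Gamma_row p M 5"] g(1) unfolding minor_def by metis
  \<comment> \<open>The two vanishing minors kill the coefficients of the Frobenius rows 3 and 4 in row 5.\<close>
  have c4: "c4 = 0" using c(4) g by simp
  have "minor p M 1 2 5 4 = - minor p M 1 2 4 5"
    unfolding minor_def by (rule det_swap_adjacent)
  then have c3: "c3 = 0" using c(3) g by simp
  have "minor p M 1 5 3 4 = minor p M 1 3 4 5"
    unfolding minor_def
    using det_swap_adjacent(2)[of "Gamma_row p M 1" "Gamma_row p M 3" "Gamma_row p M 5" "Gamma_row p M 4"]
      det_swap_adjacent(3)[of "Gamma_row p M 1" "Gamma_row p M 3" "Gamma_row p M 4" "Gamma_row p M 5"]
    by simp
  then have m1345: "minor p M 1 3 4 5 = c2 * minor p M 1 2 3 4" using c(2) by simp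
  have "minor p M 5 2 3 4 = - minor p M 2 3 4 5"
    unfolding minor_def
    using det_swap_adjacent(1)[of "Gamma_row p M 2" "Gamma_row p M 5" "Gamma_row p M 3" "Gamma_row p M 4"]
      det_swap_adjacent(2)[of "Gamma_row p M 2" "Gamma_row p M 3" "Gamma_row p M 5" "Gamma_row p M 4"]
      det_swap_adjacent(3)[of "Gamma_row p M 2" "Gamma_row p M 3" "Gamma_row p M 4" "Gamma_row p M 5"]
    by simp
  then have m2345: "minor p M 2 3 4 5 = - c1 * minor p M 1 2 3 4" using c(1) by simp
  have ab: "?a j ^ (p ^ 2) = c1 * ?a j + c2 * ?b j" for j
    using row5[of j] by (simp add: c3 c4 Gamma_row_def)
  obtain n0 n1 n2 n3 where
    row9: "\<And>j. Gamma_row p M 9 $ j = n0 * Gamma_row p M 1 $ j + n1 * Gamma_row p M 3 $ j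
       + n2 * Gamma_row p M 5 $ j + n3 * Gamma_row p M 7 $ j"
    and n3: "minor p M 1 3 5 9 = n3 * minor p M 1 3 5 7"
    using combination_of_four_rows[of "Gamma_row p M 1" "Gamma_row p M 3" "Gamma_row p M 5"
        "Gamma_row p M 7" "Gamma_row p M 9"] g(3) unfolding minor_def by metis
  \<comment> \<open>Otherwise row 5 is a multiple of row 1, and the Moore minor of rows 1, 3, 5, 7 vanishes.\<close>
  have c2: "c2 \<noteq> 0"
  proof
    assume "c2 = 0"
    then have r5: "Gamma_row p M 5 = c1 *s Gamma_row p M 1"
      using row5 by (simp add: vec_eq_iff c3 c4)
    let ?B = "vector [Gamma_row p M 1, Gamma_row p M 3, Gamma_row p M 5, Gamma_row p M 7] :: 'a^4^4"
    have "det (\<chi> i. if i = 3 then Gamma_row p M 5 else ?B $ i) =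
        (\<chi> i. if i = 1 then c1 else 0 :: 'a^4) $ 3 * det ?B"
      by (rule det_replace_row) (simp add: sum_4 r5 vector_def)
    moreover have "(\<chi> i. if i = 3 then Gamma_row p M 5 else ?B $ i) = ?B"
      unfolding vec_eq_iff[where 'b = 4] forall_4 by (simp add: vector_def)
    ultimately show False using g(3) by (simp add: minor_def)
  qed
  define A where "A = E_comb ?a ` ?G"
  have inj: "inj_on (E_comb ?a) ?G"
  proof (rule inj_onI)
    fix g h assume gh: "g \<in> ?G" "h \<in> ?G" "E_comb ?a g = E_comb ?a h"
    then have "E_comb ?a (\<lambda>j. g j - h j) = 0"
      by (simp add: E_comb_def sum_subtractf left_diff_distrib)
    then have "of_int (g j - h j) = (0::'a)" for j
      by (rule E_comb_zeroD[OF pc assms(6)])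
    then have "int p dvd g j - h j" for j
      unfolding pc(2)[symmetric] by (simp only: of_int_eq_0_iff_char_dvd)
    then have "g j mod int p = h j mod int p" for j by (simp add: mod_eq_dvd_iff)
    then show "g = h" using gh(1,2) p0 by (auto simp: carrier_elem_abelian4 fun_eq_iff)
  qed
  have comb_root: "E_comb ?a g ^ p ^ 4 = n3 * E_comb ?a g ^ p ^ 3 + n2 * E_comb ?a g ^ p ^ 2
      + n1 * E_comb ?a g ^ p + n0 * E_comb ?a g" for g
  proof -
    have "?a j ^ p ^ 4 = n3 * ?a j ^ p ^ 3 + n2 * ?a j ^ p ^ 2 + n1 * ?a j ^ p + n0 * ?a j" for j
      using row9[of j] by (simp add: Gamma_row_def)
    then show ?thesis
      using E_comb_power[OF pc, of ?a g 1]
      by (simp add: E_comb_power[OF pc]) (simp add: E_comb_def sum_4 algebra_simps)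
  qed
  \<comment> \<open>Representatives are added modulo \<open>p\<close>, which the coefficients in characteristic \<open>p\<close> do not notice.\<close>
  interpret translation_group p A c1 c2 n0 n1 n2 n3
  proof
    show "finite A" "card A = p ^ 4"
      unfolding A_def using card_carrier_elem_abelian4[OF p0] by (simp_all add: card_image[OF inj])
    have "(\<lambda>_. 0) \<in> ?G" using p0 by (simp add: carrier_elem_abelian4)
    then show "0 \<in> A" unfolding A_def by (intro image_eqI[of _ _ "\<lambda>_. 0"]) (simp_all add: E_comb_def)
    fix a assume "a \<in> A"
    then obtain g where g: "g \<in> ?G" "a = E_comb ?a g" by (auto simp: A_def)
    show "a ^ p ^ 4 = n3 * a ^ p ^ 3 + n2 * a ^ p ^ 2 + n1 * a ^ p + n0 * a"
      unfolding g(2) by (rule comb_root)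
    fix b assume "b \<in> A"
    then obtain h where h: "h \<in> ?G" "b = E_comb ?a h" by (auto simp: A_def)
    have "of_int (k mod int p) = (of_int k :: 'a)" for k
    proof -
      have "of_int (int p * (k div int p)) = (0 :: 'a)"
        using pc(2) by (simp only: of_int_eq_0_iff_char_dvd) simp
      then show ?thesis by (metis add_0 mult_div_mod_eq of_int_add)
    qed
    then have "a + b = E_comb ?a (\<lambda>j. (g j + h j) mod int p)"
      unfolding g h by (simp add: E_comb_def sum.distrib distrib_right)
    moreover have "(\<lambda>j. (g j + h j) mod int p) \<in> ?G" using p0 by (simp add: carrier_elem_abelian4)
    ultimately show "a + b \<in> A" by (auto simp: A_def)
  qed (use assms c2 in auto)
  \<comment> \<open>The second coordinate of a translation is forced by the first, through row 5.\<close>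
  have act: "E_act M g f = act (E_comb ?a g) f" if "g \<in> ?G" for g f
  proof -
    have "c2 * E_comb ?b g = E_comb (\<lambda>j. ?a j ^ (p ^ 2)) g - c1 * E_comb ?a g"
      unfolding ab by (simp add: E_comb_def sum_4 algebra_simps)
    then have "c2 * beta (E_comb ?a g) = c2 * E_comb ?b g"
      unfolding beta_eq E_comb_power[OF pc, symmetric] by (simp add: q_def)
    with c2 show ?thesis using that p0 by (simp add: act_def E_act_eq_translation)
  qed
  have Inv: "E_invariants p M = Inv"
    unfolding E_invariants_def Inv_def by (auto simp: A_def act)
  have orbit: "orbit_product p M f = (\<Prod>a\<in>A. act a f)" if "inj_on (\<lambda>a. act a f) A" for f
  proof -
    have "orbit (elem_abelian4 p) (E_act M) f = (\<lambda>a. act a f) ` A"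
    proof -
      have "orbit (elem_abelian4 p) (E_act M) f = (\<lambda>g. E_act M g f) ` ?G"
        by (auto simp: orbit_def)
      also have "\<dots> = (\<lambda>g. act (E_comb ?a g) f) ` ?G"
        by (rule image_cong) (simp_all add: act)
      finally show ?thesis by (simp add: A_def image_image)
    qed
    then show ?thesis unfolding orbit_product_def by (simp add: prod.reindex[OF that])
  qed
  have Ny: "orbit_product p M (Var Y) = Ny"
    unfolding Ny_def
  proof (subst orbit)
    show "inj_on (\<lambda>a. act a (Var Y)) A"
    proof (rule inj_onI)
      fix a b assume "act a (Var Y) = act b (Var Y)"
      then have "Const (a - b) = (0 :: (xyz, 'a) mpoly)" using X_nonzero by (simp add: Const.diff)
      then show "a = b" by simp
    qed
  qed simp
  \<comment> \<open>The coefficient \<open>2 a\<close> of \<open>y\<close> separates the orbit of \<open>z\<close>; this needs odd characteristic.\<close>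
  have Nz: "orbit_product p M (Var Z) = Nz"
    unfolding Nz_def
  proof (rule orbit, rule inj_onI)
    fix a b assume "act a (Var Z) = act b (Var Z)"
    note * = arg_cong[OF this, of "\<lambda>f. Poly_Mapping.lookup f (Poly_Mapping.single Y 1)"]
    have "Poly_Mapping.single X (1::nat) \<noteq> Poly_Mapping.single Y 1"
      by (metis lookup_single_eq lookup_single_not_eq one_neq_zero xyz.distinct(1))
    then show "a = b" using * two_nonzero
      unfolding act_def translation_simps by (simp add: Var_def lookup_add lookup_single)
  qed
  have f1: "f1_hat p M = f1"
  proof -
    have "minor p M 1 3 4 5 / minor p M 1 2 3 4 = c2" "minor p M 2 3 4 5 / minor p M 1 2 3 4 = - c1"
      using g(1) m1345 m2345 by simp_all
    then show ?thesis
      unfolding f1_hat_def f1_def eps_def g(4) q_def[symmetric] X_power_pred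
      by (simp add: Const.uminus algebra_simps)
  qed
  have "alpha1 p M = n3" using g n3 p0 by (simp add: alpha1_def)
  moreover have "alpha2 p M = c2 ^ q"
    using g(1) unfolding alpha2_def m1345 q_def by (simp add: power_mult_distrib)
  ultimately have h2t: "h2_tilde p M = h2_num * Var X ^ (q * q - q - 2)"
    unfolding h2_tilde_def Ny f1 Ny_h2_num exponent_bounds q_def[symmetric] by simp
  have h2: "h2_hat p M = h2"
  proof -
    define K :: "(xyz, 'a) mpoly" where
      "K = Const (2 * c2 ^ (q + 1) * minor p M 1 2 3 4 ^ (q + 1)) * Var X ^ (q * q - q - 2)"
    have l: "2 * Var X ^ (p ^ 4 - p ^ 2 - 2) * Const (minor p M 1 3 4 5 ^ (p ^ 2 + 1)) * h = K * h" for h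
      unfolding m1345 exponent_bounds K_def power_mult_distrib Const.mult Const_numeral
      by (simp only: ac_simps)
    have r: "Const (minor p M 1 2 3 4 ^ (p ^ 2 + 1)) * h2_tilde p M = K * h2"
      unfolding h2t h2_num_eq exponent_bounds K_def Const.mult by (simp only: ac_simps)
    have "K \<noteq> 0" using c2 two_nonzero g(1) X_nonzero by (simp add: K_def)
    then show ?thesis unfolding h2_hat_def l r by (intro the_equality) simp_all
  qed
  have gens: "(\<lambda>i. generators p M $ i) = gen"
    by (rule ext) (simp add: generators_def gen_def f1 h2 Nz)
  have "range gen = {Var X, f1_hat p M, h2_hat p M, orbit_product p M (Var Z)}"
    unfolding UNIV_4 by (simp add: f1 h2 Nz)
  then show ?thesis
    using sagbi_basis_gen tete_a_tete_exists tete_a_tete_hypersurface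
    unfolding Let_def gens Inv q_def by simp
qed

end
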